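(* Let $r\in\mathbb Z_{>0}$ and $d\in\mathbb Z$. Then the following hold. (1) There is a natural bijection between $M_{\mathrm{ch}}^{ss}(r,d)$ and $M_{\mathrm{ch}}^{ss}(r,d+r)$, and if $0<d<r$ then there is a natural bijection between $M_{\mathrm{ch}}^{ss}(r,d)$ and $M_{\mathrm{ch}}^{ss}(d,d-r)$. As a corollary, there is a bijection between $M_{\mathrm{ch}}^{ss}(r,d)$ and $M_{\mathrm{ch}}^{ss}(h,0)$, where $h=\gcd(r,d)$. The same assertions hold with $M_{\mathrm{ch}}^{ss}$ replaced throughout by $M_{\mathrm{ch}}^{s}$, by $M_{\mathrm{cyc}}^{s}$, and by $M_{\mathrm{cyc}}^{ss}$. (2) The set $M_{\mathrm{ch}}^{ss}(r,d)$ is finite and non-empty. If $r$ and $d$ are coprime then $M_{\mathrm{ch}}^{s}(r,d)=M_{\mathrm{ch}}^{ss}(r,d)$ and this set contains exactly one element. Otherwise, $M_{\mathrm{ch}}^{s}(r,d)$ is empty. The same assertions hold for cycles, i.e. with $M_{\mathrm{ch}}^{ss},M_{\mathrm{ch}}^{s}$ replaced by $M_{\mathrm{cyc}}^{ss},M_{\mathrm{cyc}}^{s}$.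
   Context: A chain is a finite (nonempty) sequence of integers. A cycle is an equivalence class of chains under the equivalence generated by the cyclic shift $(a_1,\dots,a_r)\sim(a_2,\dots,a_r,a_1)$; a cycle is denoted by a representing sequence. A cycle is aperiodic if its sequence cannot be written as a concatenation of equal proper subsequences. A subchain of a chain $(a_1,\dots,a_r)$ is a chain $(a_i,a_{i+1},\dots,a_j)$ with $1\le i\le j\le r$. A subchain of a cycle $(a_1,\dots,a_r)$ is a chain $(a_i,a_{i+1},\dots,a_{i+l})$ with $1\le i\le r$, $0\le l<r$, indices taken modulo $r$. A subchain is proper if its length is less than $r$. For a chain $\mathbf a=(a_1,\dots,a_r)$: $\deg\mathbf a=\sum a_i-1$, rank $r$, slope $\mu(\mathbf a)=\deg\mathbf a/r$. For a cycle $\mathbf a=(a_1,\dots,a_r)$: $\deg\mathbf a=\sum a_i$, rank $r$, slope $\mu(\mathbf a)=\deg\mathbf a/r$. A chain or cycle $\mathbf a$ is semistable if $\mu(\mathbf b)\le\mu(\mathbf a)$ for every subchain $\mathbf b$ of $\mathbf a$ (the slope of $\mathbf b$ being that of a chain), and stable if moreover the inequality is strict for every proper subchain. $M_{\mathrm{ch}}^{ss}(r,d)$ (resp. $M_{\mathrm{ch}}^{s}(r,d)$) is the set of semistable (resp. stable) chains of rank $r$ and degree $d$. $M_{\mathrm{cyc}}^{ss}(r,d)$ (resp. $M_{\mathrm{cyc}}^{s}(r,d)$) is the set of aperiodic semistable (resp. aperiodic stable) cycles of rank $r$ and degree $d$. *)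

theory Defs
  imports Complex_Main "HOL-Library.Sublist"
begin

section \<open>Chains\<close>

text \<open>
  A chain is a nonempty list of integers. The rank of a chain is its length. Nonemptiness is
  imposed wherever chains are quantified over or collected into a set.
\<close>

definition chain_deg :: "int list \<Rightarrow> int" where
  "chain_deg a = sum_list a - 1"

definition chain_slope :: "int list \<Rightarrow> rat" where
  "chain_slope a = of_int (chain_deg a) / of_nat (length a)"

text \<open>\<^const>\<open>sublist\<close> is the contiguous-subword relation.\<close>

definition chain_subchains :: "int list \<Rightarrow> int list set" where
  "chain_subchains a = {b. b \<noteq> [] \<and> sublist b a}"

definition chain_semistable :: "int list \<Rightarrow> bool" where
  "chain_semistable a \<longleftrightarrow> (\<forall>b\<in>chain_subchains a. chain_slope b \<le> chain_slope a)"

definition chain_stable :: "int list \<Rightarrow> bool" where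
  "chain_stable a \<longleftrightarrow> chain_semistable a \<and>
     (\<forall>b\<in>chain_subchains a. length b < length a \<longrightarrow> chain_slope b < chain_slope a)"

definition M_ch_ss :: "int \<Rightarrow> int \<Rightarrow> int list set" where
  "M_ch_ss r d = {a. a \<noteq> [] \<and> int (length a) = r \<and> chain_deg a = d \<and> chain_semistable a}"

definition M_ch_s :: "int \<Rightarrow> int \<Rightarrow> int list set" where
  "M_ch_s r d = {a. a \<noteq> [] \<and> int (length a) = r \<and> chain_deg a = d \<and> chain_stable a}"


section \<open>Cycles\<close>

definition cyc_eq :: "int list \<Rightarrow> int list \<Rightarrow> bool" where
  "cyc_eq a b \<longleftrightarrow> a \<noteq> [] \<and> b \<noteq> [] \<and> equivclp (\<lambda>x y. y = rotate1 x) a b"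

lemma cyc_eq_invariant:
  assumes "cyc_eq a b" and inv: "\<And>x. f (rotate1 x) = f x"
  shows "f a = f b"
proof -
  have "equivclp (\<lambda>x y. y = rotate1 x) a b"
    using assms(1) by (simp add: cyc_eq_def)
  then show ?thesis
    by (induction rule: equivclp_induct) (auto simp: inv)
qed

lemma cyc_eq_refl: "a \<noteq> [] \<Longrightarrow> cyc_eq a a"
  by (simp add: cyc_eq_def)

lemma cyc_eq_sym: "cyc_eq a b \<Longrightarrow> cyc_eq b a"
  by (auto simp: cyc_eq_def intro: equivclp_sym)

lemma cyc_eq_trans: "cyc_eq a b \<Longrightarrow> cyc_eq b c \<Longrightarrow> cyc_eq a c"
  by (auto simp: cyc_eq_def intro: equivclp_trans)

quotient_type cycle = "int list" / partial: cyc_eq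
proof (rule part_equivpI)
  show "\<exists>a. cyc_eq a a" using cyc_eq_refl[of "[0]"] by auto
  show "symp cyc_eq" by (auto intro: sympI cyc_eq_sym)
  show "transp cyc_eq" by (auto intro: transpI cyc_eq_trans)
qed

lift_definition cyc_rank :: "cycle \<Rightarrow> nat" is length
  by (erule cyc_eq_invariant) simp

lift_definition cyc_deg :: "cycle \<Rightarrow> int" is sum_list
proof (erule cyc_eq_invariant)
  show "sum_list (rotate1 x) = sum_list x" for x :: "int list"
    by (cases x) simp_all
qed

definition cyc_slope :: "cycle \<Rightarrow> rat" where
  "cyc_slope c = of_int (cyc_deg c) / of_nat (cyc_rank c)"

definition seq_aperiodic :: "int list \<Rightarrow> bool" where
  "seq_aperiodic a \<longleftrightarrow> (\<nexists>b n. length b < length a \<and> a = concat (replicate n b))"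

lemma rotate1_concat_replicate:
  "rotate1 (concat (replicate n b)) = concat (replicate n (rotate1 b))"
proof (cases b)
  case (Cons x xs)
  have *: "xs @ concat (replicate n (x # xs)) @ [x]
           = (xs @ [x]) @ concat (replicate n (xs @ [x]))" for n
    by (induction n) simp_all
  show ?thesis
    using *[of "n - 1"] Cons by (cases n) simp_all
qed simp

lemma seq_aperiodic_rotate1: "seq_aperiodic (rotate1 a) = seq_aperiodic a"
proof -
  let ?per = "\<lambda>x :: int list. \<exists>b n. length b < length x \<and> x = concat (replicate n b)"
  have fwd: "?per (rotate1 x)" if "?per x" for x
    using that by (metis rotate1_concat_replicate length_rotate1)
  have rot: "?per (rotate k x)" if "?per x" for x k
  proof (induction k)
    case (Suc k)
    from fwd[OF this] show ?case by (simp only: rotate_Suc)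
  qed (use that in simp)
  have "rotate (length a - 1) (rotate1 a) = a"
  proof (cases a)
    case (Cons x xs)
    then show ?thesis
      using rotate_append[of xs "[x]"] by simp
  qed simp
  then show ?thesis
    unfolding seq_aperiodic_def using fwd[of a] rot[of "rotate1 a" "length a - 1"] by metis
qed

lift_definition cyc_aperiodic :: "cycle \<Rightarrow> bool" is seq_aperiodic
  by (erule cyc_eq_invariant) (rule seq_aperiodic_rotate1)

text \<open>
  With indices starting at 0, the subchains of a cycle of rank r represented by a are
  a(i), a(i+1), ..., a(i+l) with i, l < r and indices modulo r. They are chains, so their slope
  is \<^const>\<open>chain_slope\<close>.
\<close>

definition seq_cyc_subchains :: "int list \<Rightarrow> int list set" where
  "seq_cyc_subchains a =
     {map (\<lambda>k. a ! ((i + k) mod length a)) [0..<Suc l] | i l. i < length a \<and> l < length a}"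

lemma seq_cyc_subchains_rotate1: "seq_cyc_subchains (rotate1 a) = seq_cyc_subchains a"
proof (cases "a = []")
  case False
  let ?r = "length a"
  let ?sub = "\<lambda>x i l. map (\<lambda>k. x ! ((i + k) mod ?r)) [0..<Suc l] :: int list"
  have r: "?r > 0" using False by simp
  have shift: "?sub (rotate1 a) i l = ?sub a (Suc i mod ?r) l" for i l
  proof (rule map_cong[OF refl])
    fix k
    have "rotate1 a ! ((i + k) mod ?r) = a ! (Suc ((i + k) mod ?r) mod ?r)"
      using r by (simp add: nth_rotate1)
    also have "Suc ((i + k) mod ?r) mod ?r = (Suc i mod ?r + k) mod ?r"
      by (simp add: mod_Suc_eq mod_add_left_eq)
    finally show "rotate1 a ! ((i + k) mod ?r) = a ! ((Suc i mod ?r + k) mod ?r)" .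
  qed
  have surj: "\<exists>j<?r. i = Suc j mod ?r" if "i < ?r" for i
  proof (cases i)
    case 0
    then show ?thesis using r by (intro exI[of _ "?r - 1"]) simp
  next
    case (Suc j)
    then show ?thesis using that by (intro exI[of _ j]) simp
  qed
  show ?thesis
  proof (intro equalityI subsetI)
    fix b assume "b \<in> seq_cyc_subchains (rotate1 a)"
    then obtain i l where "i < ?r" "l < ?r" "b = ?sub (rotate1 a) i l"
      unfolding seq_cyc_subchains_def by auto
    then show "b \<in> seq_cyc_subchains a"
      unfolding seq_cyc_subchains_def shift using r
      by (intro CollectI exI[of _ "Suc i mod ?r"] exI[of _ l]) simp
  next
    fix b assume "b \<in> seq_cyc_subchains a"
    then obtain i l where il: "i < ?r" "l < ?r" "b = ?sub a i l"
      unfolding seq_cyc_subchains_def by auto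
    then obtain j where "j < ?r" "i = Suc j mod ?r" using surj by blast
    then have "j < ?r \<and> b = ?sub (rotate1 a) j l"
      using il(3) shift[of j l] by simp
    then show "b \<in> seq_cyc_subchains (rotate1 a)"
      unfolding seq_cyc_subchains_def using il(2)
      by (intro CollectI exI[of _ j] exI[of _ l]) simp
  qed
qed simp

lift_definition cyc_subchains :: "cycle \<Rightarrow> int list set" is seq_cyc_subchains
  by (erule cyc_eq_invariant) (rule seq_cyc_subchains_rotate1)

definition cyc_semistable :: "cycle \<Rightarrow> bool" where
  "cyc_semistable c \<longleftrightarrow> (\<forall>b\<in>cyc_subchains c. chain_slope b \<le> cyc_slope c)"

definition cyc_stable :: "cycle \<Rightarrow> bool" where
  "cyc_stable c \<longleftrightarrow> cyc_semistable c \<and>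
     (\<forall>b\<in>cyc_subchains c. length b < cyc_rank c \<longrightarrow> chain_slope b < cyc_slope c)"

definition M_cyc_ss :: "int \<Rightarrow> int \<Rightarrow> cycle set" where
  "M_cyc_ss r d =
     {c. int (cyc_rank c) = r \<and> cyc_deg c = d \<and> cyc_aperiodic c \<and> cyc_semistable c}"

definition M_cyc_s :: "int \<Rightarrow> int \<Rightarrow> cycle set" where
  "M_cyc_s r d =
     {c. int (cyc_rank c) = r \<and> cyc_deg c = d \<and> cyc_aperiodic c \<and> cyc_stable c}"


section \<open>The natural maps\<close>

text \<open>
  The first map adds 1 to every entry, raising the degree by the rank.

  The second one underlies the bijection between rank r, degree d and rank d, degree d - r for
  0 < d < r. There, a semistable chain or cycle of rank r and degree d has all entries in {0, 1},
  and a semistable chain or cycle of rank d and degree d - r has all entries nonpositive. The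
  sequence (-k1, ..., -kd) corresponds to the chain (1, 0^k1, 1, 0^k2, ..., 1, 0^kd, 1) and to the
  cycle (1, 0^k1, 1, 0^k2, ..., 1, 0^kd), where 0^k stands for k consecutive zeros. The map is
  given in the direction from (d, d - r) to (r, d), in which the formula makes sense for all
  sequences and is visibly compatible with cyclic shifts. Its values on sequences with positive
  entries are irrelevant.
\<close>

definition chain_twist :: "int list \<Rightarrow> int list" where
  "chain_twist a = map (\<lambda>x. x + 1) a"

definition expand :: "int list \<Rightarrow> int list" where
  "expand a = concat (map (\<lambda>x. 1 # replicate (nat (- x)) 0) a)"

definition chain_expand :: "int list \<Rightarrow> int list" where
  "chain_expand a = expand a @ [1]"

lemma cyc_eq_rotate1: "x \<noteq> [] \<Longrightarrow> cyc_eq x (rotate1 x)"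
  by (auto simp: cyc_eq_def)

lemma cyc_eq_rotate: "x \<noteq> [] \<Longrightarrow> cyc_eq x (rotate n x)"
proof (induction n)
  case (Suc n)
  then show ?case
    using cyc_eq_trans[OF _ cyc_eq_rotate1[of "rotate n x"]] by simp
qed (simp add: cyc_eq_refl)

lemma cyc_eq_map:
  assumes "cyc_eq a b"
    and ne: "\<And>x. x \<noteq> [] \<Longrightarrow> f x \<noteq> []"
    and rot: "\<And>x. x \<noteq> [] \<Longrightarrow> \<exists>n. f (rotate1 x) = rotate n (f x)"
  shows "cyc_eq (f a) (f b)"
proof -
  have a: "a \<noteq> []" and eq: "equivclp (\<lambda>x y. y = rotate1 x) a b"
    using assms(1) by (simp_all add: cyc_eq_def)
  have step: "cyc_eq (f x) (f (rotate1 x))" if "x \<noteq> []" for x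
    using rot[OF that] cyc_eq_rotate[OF ne[OF that]] by auto
  from eq have "b \<noteq> [] \<and> cyc_eq (f a) (f b)"
  proof (induction rule: equivclp_induct)
    case base
    then show ?case using a by (simp add: cyc_eq_refl ne)
  next
    case (step y z)
    have "z \<noteq> []" using step by (metis length_0_conv length_rotate1)
    moreover have "cyc_eq (f y) (f z)"
      using step \<open>z \<noteq> []\<close> \<open>\<And>x. x \<noteq> [] \<Longrightarrow> cyc_eq (f x) (f (rotate1 x))\<close> cyc_eq_sym by metis
    ultimately show ?case using step cyc_eq_trans by blast
  qed
  then show ?thesis ..
qed

lift_definition cyc_twist :: "cycle \<Rightarrow> cycle" is "map (\<lambda>x. x + 1)"
proof (erule cyc_eq_map)
  show "\<exists>n. map (\<lambda>x. x + 1) (rotate1 x) = rotate n (map (\<lambda>x. x + 1) x)" for x :: "int list"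
    by (rule exI[of _ 1]) (simp add: rotate1_map)
qed simp

lift_definition cyc_expand :: "cycle \<Rightarrow> cycle" is expand
proof (erule cyc_eq_map)
  show "expand x \<noteq> []" if "x \<noteq> []" for x
    using that by (cases x) (simp_all add: expand_def)
  show "\<exists>n. expand (rotate1 x) = rotate n (expand x)" if ne: "x \<noteq> []" for x
  proof (cases x)
    case (Cons y ys)
    then have "expand (rotate1 x) = expand ys @ expand [y]" "expand x = expand [y] @ expand ys"
      by (simp_all add: expand_def)
    then show ?thesis by (metis rotate_append)
  qed (use ne in simp)
qed

end

theory Submission
  imports Defs "HOL-Library.Equipollence"
begin

text \<open>
  In the expansion of a sequence with nonpositive entries, a subword of positive degree is steepest
  when it begins and ends with 1, and then it is \<open>expand e\<close> followed by 1 for a subword \<open>e\<close> of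
  the original sequence. Slopes there are a monotone function of the slopes of the corresponding
  \<open>e\<close>, so expansion preserves and reflects (semi)stability. Bounding a single entry and its
  complement shows that for \<open>0 < d < r\<close> all entries lie in {0, 1}, hence every object is an
  expansion. Twisting and expanding then run the Euclidean algorithm on \<open>(r, d)\<close> down to degree 0,
  where everything is read off directly.
\<close>

section \<open>Slope bounds on subwords\<close>

text \<open>The monotone function of slopes is mu -> 1 / (1 - mu), increasing below 1; it takes (d -
  r)/d to d/r. The degree of a subchain is its sum minus 1 for chains and cycles alike, and the
  closing 1 in \<open>expand e @ [1]\<close> absorbs exactly this correction, so one comparison
  serves both. With denominators cleared it is an equivalence of integer inequalities with the same
  margin 0 or 1 on both sides, which is why semistable and stable objects can be treated together.
  Two obstacles remain. A subword with at most one 1 comes from no nonempty subword of the original,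
  but its degree is at most 0 and hence harmless when \<open>d > 0\<close>. An expansion begins with
  1 and so remembers a starting point, which a cycle lacks: on representatives, injectivity and
  surjectivity hold only up to rotation, and aperiodicity has to be transported separately. In
  degree 0 it is aperiodicity that excludes the zero cycles of rank above 1, which would otherwise
  be stable.\<close>

text \<open>
  Slopes are compared after clearing denominators. For integers a strict inequality is a weak one
  with 1 added on the left, so \<open>e = 0\<close> encodes semistability and \<open>e = 1\<close> stability.
  In \<open>cyc_lists\<close> no length restriction is imposed on the subwords of \<open>a @ a\<close>: those of length at
  least \<open>length a\<close> satisfy the bound as soon as the shorter ones do.
\<close>

definition slope_bound :: "int \<Rightarrow> int \<Rightarrow> int \<Rightarrow> int list \<Rightarrow> bool" where
  "slope_bound e r d b \<longleftrightarrow> r * (sum_list b - 1) + e \<le> d * int (length b)"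

definition ch_lists :: "int \<Rightarrow> int \<Rightarrow> int \<Rightarrow> int list set" where
  "ch_lists e r d = {a. a \<noteq> [] \<and> int (length a) = r \<and> sum_list a = d + 1 \<and>
     (\<forall>b. b \<noteq> [] \<longrightarrow> sublist b a \<longrightarrow> length b < length a \<longrightarrow> slope_bound e r d b)}"

definition cyc_lists :: "int \<Rightarrow> int \<Rightarrow> int \<Rightarrow> int list set" where
  "cyc_lists e r d = {a. a \<noteq> [] \<and> int (length a) = r \<and> sum_list a = d \<and> seq_aperiodic a \<and>
     (\<forall>b. b \<noteq> [] \<longrightarrow> sublist b (a @ a) \<longrightarrow> slope_bound e r d b)}"

lemma of_int_divide_le_iff:
  assumes "m > 0" "n > 0"
  shows "(of_int x / of_nat m :: rat) \<le> of_int y / of_nat n \<longleftrightarrow> int n * x \<le> y * int m"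
proof -
  have "(of_int x / of_nat m :: rat) \<le> of_int y / of_nat n \<longleftrightarrow>
      (of_int (int n * x) :: rat) \<le> of_int (y * int m)"
    using assms by (simp add: divide_simps mult.commute)
  then show ?thesis by (simp only: of_int_le_iff)
qed

lemma of_int_divide_less_iff:
  assumes "m > 0" "n > 0"
  shows "(of_int x / of_nat m :: rat) < of_int y / of_nat n \<longleftrightarrow> int n * x + 1 \<le> y * int m"
  unfolding less_le_not_le using of_int_divide_le_iff[of n m y x] of_int_divide_le_iff[of m n x y] assms
  by (auto simp: mult.commute)

lemma sublist_full_length:
  assumes "sublist b a" "\<not> length b < length a"
  shows "b = a"
  using assms by (auto simp: sublist_def)

section \<open>Slopes of chains as integer inequalities\<close>

lemma M_ch_ss_eq: "M_ch_ss r d = ch_lists 0 r d"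
proof -
  have "chain_semistable a \<longleftrightarrow>
      (\<forall>b. b \<noteq> [] \<longrightarrow> sublist b a \<longrightarrow> length b < length a \<longrightarrow> slope_bound 0 r d b)"
    if a: "a \<noteq> []" "int (length a) = r" "sum_list a = d + 1" for a
  proof -
    have "chain_slope b \<le> chain_slope a \<longleftrightarrow> slope_bound 0 r d b" if "b \<noteq> []" for b
      using that a of_int_divide_le_iff[of "length b" "length a" "sum_list b - 1" "sum_list a - 1"]
      by (simp add: chain_slope_def chain_deg_def slope_bound_def)
    moreover have "b = a" if "sublist b a" "\<not> length b < length a" for b
      using that by (rule sublist_full_length)
    ultimately show ?thesis
      unfolding chain_semistable_def chain_subchains_def by blast
  qed
  then show ?thesis
    unfolding M_ch_ss_def ch_lists_def chain_deg_def by auto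
qed

text \<open>The only subword of full length is \<open>a\<close> itself. It attains the slope of
  \<open>a\<close>, so the weak inequality holds for it while the bound with margin 1 fails; hence
  \<open>ch_lists\<close> tests proper subwords only.\<close>

lemma M_ch_s_eq: "M_ch_s r d = ch_lists 1 r d"
proof -
  have "chain_stable a \<longleftrightarrow>
      (\<forall>b. b \<noteq> [] \<longrightarrow> sublist b a \<longrightarrow> length b < length a \<longrightarrow> slope_bound 1 r d b)"
      (is "?L \<longleftrightarrow> ?R")
    if a: "a \<noteq> []" "int (length a) = r" "sum_list a = d + 1" for a
  proof -
    have iff: "chain_slope b < chain_slope a \<longleftrightarrow> slope_bound 1 r d b" if "b \<noteq> []" for b
      using that a of_int_divide_less_iff[of "length b" "length a" "sum_list b - 1" "sum_list a - 1"]
      by (simp add: chain_slope_def chain_deg_def slope_bound_def)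
    show ?thesis
    proof
      assume ?L
      then show ?R using iff by (auto simp: chain_stable_def chain_subchains_def)
    next
      assume R: ?R
      have "chain_slope b \<le> chain_slope a" if "b \<noteq> []" "sublist b a" for b
      proof (cases "length b < length a")
        case True
        then show ?thesis using iff[OF that(1)] R that by (simp add: less_imp_le)
      qed (use sublist_full_length that in auto)
      then show ?L
        using iff R by (auto simp: chain_stable_def chain_semistable_def chain_subchains_def)
    qed
  qed
  then show ?thesis
    unfolding M_ch_s_def ch_lists_def chain_deg_def by auto
qed

section \<open>Windows of a cycle as subwords of the doubled word\<close>

text \<open>An occurrence starting in the second copy of \<open>a\<close> lies entirely in that copy
  and can be moved back by one period.\<close>

lemma sublist_double_cases:
  assumes "sublist b (a @ a)" "length b \<le> length a" "b \<noteq> []"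
  obtains i where "i < length a" "b = take (length b) (drop i (a @ a))"
proof -
  obtain p q where pq: "a @ a = p @ b @ q" using assms(1) by (auto simp: sublist_def)
  show thesis
  proof (cases "length p < length a")
    case True
    have "b = take (length b) (drop (length p) (a @ a))" unfolding pq by simp
    then show thesis using True that by blast
  next
    case False
    define i where "i = length p - length a"
    have len: "length p + length b + length q = length a + length a"
      using arg_cong[OF pq, of length] by simp
    have "b = take (length b) (drop (length p) (a @ a))" unfolding pq by simp
    also have "\<dots> = take (length b) (drop i a)"
      using False by (simp add: i_def)
    also have "\<dots> = take (length b) (drop i (a @ a))"
      using len False by (simp add: i_def)
    finally have "b = take (length b) (drop i (a @ a))" .
    moreover have "i < length a" using len False assms(3) by (cases b) (auto simp: i_def)
    ultimately show thesis using that by blast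
  qed
qed

text \<open>A window of at most full length wraps around at most once, so writing the word twice
  unrolls all index arithmetic modulo the rank.\<close>

lemma seq_cyc_subchains_eq:
  "seq_cyc_subchains a = {b. b \<noteq> [] \<and> length b \<le> length a \<and> sublist b (a @ a)}"
proof -
  have win: "map (\<lambda>k. a ! ((i + k) mod length a)) [0..<Suc l] = take (Suc l) (drop i (a @ a))"
    if "i < length a" "l < length a" for i l
  proof (rule nth_equalityI)
    fix k assume "k < length (map (\<lambda>k. a ! ((i + k) mod length a)) [0..<Suc l])"
    then have k: "k \<le> l" by simp
    show "map (\<lambda>k. a ! ((i + k) mod length a)) [0..<Suc l] ! k = take (Suc l) (drop i (a @ a)) ! k"
    proof (cases "i + k < length a")
      case True
      then have "k < length a - i" by simp
      then show ?thesis using True k that by (simp add: nth_append del: upt_Suc)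
    next
      case False
      then have "(i + k) mod length a = i + k - length a"
        using le_mod_geq[of "length a" "i + k"] k that by simp
      then show ?thesis using False k that by (simp add: nth_append del: upt_Suc drop_append)
    qed
  qed (use that in simp)
  have len: "length (take (Suc l) (drop i (a @ a))) = Suc l" if "i < length a" "l < length a" for i l
    using that by simp
  have sub: "sublist (take m (drop i xs)) xs" for m i and xs :: "int list"
    by (metis append_take_drop_id sublist_appendI)
  show ?thesis
  proof (intro equalityI subsetI)
    fix b assume "b \<in> seq_cyc_subchains a"
    then obtain i l where il: "i < length a" "l < length a" "b = take (Suc l) (drop i (a @ a))"
      unfolding seq_cyc_subchains_def mem_Collect_eq by (metis win)
    then have "length b = Suc l" "sublist b (a @ a)"
      using sub[of "Suc l" i "a @ a"] len[of i l] by simp_all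
    then show "b \<in> {b. b \<noteq> [] \<and> length b \<le> length a \<and> sublist b (a @ a)}"
      using il(2) by auto
  next
    fix b assume "b \<in> {b. b \<noteq> [] \<and> length b \<le> length a \<and> sublist b (a @ a)}"
    then have b: "b \<noteq> []" "length b \<le> length a" "sublist b (a @ a)" by auto
    obtain i where i: "i < length a" "b = take (length b) (drop i (a @ a))"
      using sublist_double_cases[OF b(3,2,1)] by blast
    obtain l where l: "length b = Suc l" using b(1) by (cases b) auto
    then have "b = map (\<lambda>k. a ! ((i + k) mod length a)) [0..<Suc l] \<and> i < length a \<and> l < length a"
      using win[of i l] i b(2) by (simp del: upt_Suc)
    then show "b \<in> seq_cyc_subchains a"
      unfolding seq_cyc_subchains_def by (intro CollectI exI[of _ i] exI[of _ l])
  qed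
qed

text \<open>Such a window is a rotation of \<open>a\<close>.\<close>

lemma sum_list_full_window:
  assumes "sublist b (a @ a)" "length b = length a"
  shows "sum_list b = (sum_list a :: int)"
proof (cases "a = []")
  case False
  then have "length b \<le> length a" "b \<noteq> []" using assms(2) by auto
  then obtain i where i: "i < length a" "b = take (length b) (drop i (a @ a))"
    using sublist_double_cases[OF assms(1)] by blast
  then have "b = drop i a @ take i a" using assms(2) by simp
  then have "sum_list b = sum_list (take i a) + sum_list (drop i a)" by simp
  also have "\<dots> = sum_list a" by (metis append_take_drop_id sum_list_append)
  finally show ?thesis .
qed (use assms in simp)

text \<open>Cutting off a full period lowers both sides of the bound by \<open>r * d\<close>.\<close>

lemma slope_bound_double:
  assumes a: "a \<noteq> []" "int (length a) = r" "sum_list a = d" and e: "e \<le> 1"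
    and short: "\<And>b. b \<noteq> [] \<Longrightarrow> sublist b (a @ a) \<Longrightarrow> length b < length a \<Longrightarrow> slope_bound e r d b"
    and b: "b \<noteq> []" "sublist b (a @ a)"
  shows "slope_bound e r d b"
proof (cases "length b < length a")
  case True
  then show ?thesis using short b by blast
next
  case False
  define u v where "u = take (length a) b" and "v = drop (length a) b"
  have bu: "b = u @ v" by (simp add: u_def v_def)
  have r: "r \<ge> 1" using a by (cases a) auto
  have lu: "length u = length a" using False by (simp add: u_def)
  have "sublist u b" "sublist v b"
    by (simp_all add: bu)
  then have uv: "sublist u (a @ a)" "sublist v (a @ a)"
    using b(2) sublist_order.order.trans by blast+
  have su: "sum_list u = d" using sum_list_full_window[OF uv(1) lu] a by simp
  have lv: "length v \<le> length a"
    using sublist_length_le[OF b(2)] lu by (simp add: bu)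
  \<comment> \<open>If the remainder \<open>v\<close> is empty or a full period, the bound comes
    down to \<open>e \<le> r\<close>; this is where \<open>e \<le> 1\<close> enters.\<close>
  have "r * (sum_list v - 1) + e \<le> d * int (length v)"
  proof (cases "length v < length a")
    case True
    then show ?thesis
      using short[OF _ uv(2)] r e by (cases "v = []") (auto simp: slope_bound_def)
  next
    case False
    then have "sum_list v = d" using sum_list_full_window[OF uv(2)] lv a by simp
    then show ?thesis using False lv a(2) r e by (simp add: algebra_simps)
  qed
  then show ?thesis
    by (simp add: bu su slope_bound_def lu a algebra_simps)
qed

section \<open>Cycles as words up to rotation\<close>

lemma cyc_eq_iff_rotate: "cyc_eq a b \<longleftrightarrow> a \<noteq> [] \<and> (\<exists>n. b = rotate n a)"
proof
  assume ab: "cyc_eq a b"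
  then have "equivclp (\<lambda>x y. y = rotate1 x) a b" by (simp add: cyc_eq_def)
  then have "\<exists>n. b = rotate n a"
  proof (induction rule: equivclp_induct)
    case base
    show ?case by (rule exI[of _ 0]) simp
  next
    case (step y z)
    then obtain n where n: "y = rotate n a" by blast
    from step(2) show ?case
    proof
      assume "z = rotate1 y"
      then show ?thesis using n by (metis rotate_Suc)
    next
      assume y: "y = rotate1 z"
      \<comment> \<open>The generated equivalence also allows backward steps; undoing one shift
        amounts to \<open>length z - 1\<close> forward shifts.\<close>
      have "z = rotate (length z - 1) (rotate1 z)"
      proof (cases z)
        case (Cons x xs)
        then show ?thesis using rotate_append[of xs "[x]"] by simp
      qed simp
      then show ?thesis using n y by (metis rotate_rotate)
    qed
  qed
  then show "a \<noteq> [] \<and> (\<exists>n. b = rotate n a)" using ab by (simp add: cyc_eq_def)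
qed (auto intro: cyc_eq_rotate)

lemma abs_cycle_eq_iff:
  "a \<noteq> [] \<Longrightarrow> b \<noteq> [] \<Longrightarrow> abs_cycle a = abs_cycle b \<longleftrightarrow> (\<exists>n. b = rotate n a)"
proof -
  assume "a \<noteq> []" "b \<noteq> []"
  then have "abs_cycle a = abs_cycle b \<longleftrightarrow> cyc_eq a b"
    using Quotient3_rel[OF Quotient3_cycle, of a b] by (simp add: cyc_eq_refl)
  then show ?thesis using \<open>a \<noteq> []\<close> by (simp add: cyc_eq_iff_rotate)
qed

lemma cycle_cases:
  obtains a where "a \<noteq> []" "c = abs_cycle a"
  by (induction c rule: cycle.abs_induct) (auto simp: cyc_eq_def)

lemma mem_M_cyc_ss_iff:
  assumes a: "a \<noteq> []"
  shows "abs_cycle a \<in> M_cyc_ss r d \<longleftrightarrow> a \<in> cyc_lists 0 r d"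
proof -
  note [simp] = cyc_rank.abs_eq[OF cyc_eq_refl[OF a]] cyc_deg.abs_eq[OF cyc_eq_refl[OF a]]
    cyc_aperiodic.abs_eq[OF cyc_eq_refl[OF a]] cyc_subchains.abs_eq[OF cyc_eq_refl[OF a]]
  have "cyc_semistable (abs_cycle a) \<longleftrightarrow>
      (\<forall>b. b \<noteq> [] \<longrightarrow> sublist b (a @ a) \<longrightarrow> slope_bound 0 r d b)"
    if rd: "int (length a) = r" "sum_list a = d"
  proof -
    have "chain_slope b \<le> cyc_slope (abs_cycle a) \<longleftrightarrow> slope_bound 0 r d b" if "b \<noteq> []" for b
      using that a rd of_int_divide_le_iff[of "length b" "length a" "sum_list b - 1" "sum_list a"]
      by (simp add: chain_slope_def cyc_slope_def chain_deg_def slope_bound_def)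
    then have "cyc_semistable (abs_cycle a) \<longleftrightarrow>
        (\<forall>b. b \<noteq> [] \<longrightarrow> length b \<le> length a \<longrightarrow> sublist b (a @ a) \<longrightarrow> slope_bound 0 r d b)"
      unfolding cyc_semistable_def by (auto simp: seq_cyc_subchains_eq)
    then show ?thesis using slope_bound_double[OF a rd, of 0] by fastforce
  qed
  then show ?thesis using a by (auto simp: M_cyc_ss_def cyc_lists_def)
qed

lemma mem_M_cyc_s_iff:
  assumes a: "a \<noteq> []"
  shows "abs_cycle a \<in> M_cyc_s r d \<longleftrightarrow> a \<in> cyc_lists 1 r d"
proof -
  note [simp] = cyc_rank.abs_eq[OF cyc_eq_refl[OF a]] cyc_deg.abs_eq[OF cyc_eq_refl[OF a]]
    cyc_aperiodic.abs_eq[OF cyc_eq_refl[OF a]] cyc_subchains.abs_eq[OF cyc_eq_refl[OF a]]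
  have "cyc_stable (abs_cycle a) \<longleftrightarrow>
      (\<forall>b. b \<noteq> [] \<longrightarrow> sublist b (a @ a) \<longrightarrow> slope_bound 1 r d b)" (is "?L \<longleftrightarrow> ?R")
    if rd: "int (length a) = r" "sum_list a = d"
  proof -
    have le: "chain_slope b < cyc_slope (abs_cycle a) \<longleftrightarrow> slope_bound 1 r d b" if "b \<noteq> []" for b
      using that a rd of_int_divide_less_iff[of "length b" "length a" "sum_list b - 1" "sum_list a"]
      by (simp add: chain_slope_def cyc_slope_def chain_deg_def slope_bound_def)
    show ?thesis
    proof
      assume ?L
      then have "slope_bound 1 r d b" if "b \<noteq> []" "sublist b (a @ a)" "length b < length a" for b
        using that le unfolding cyc_stable_def by (auto simp: seq_cyc_subchains_eq)
      then show ?R using slope_bound_double[OF a rd, of 1] by fastforce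
    next
      assume ?R
      then show ?L using le unfolding cyc_stable_def cyc_semistable_def
        by (auto simp: seq_cyc_subchains_eq less_imp_le)
    qed
  qed
  then show ?thesis using a by (auto simp: M_cyc_s_def cyc_lists_def)
qed

lemma M_cyc_ss_eq: "M_cyc_ss r d = abs_cycle ` cyc_lists 0 r d"
proof -
  have "c \<in> M_cyc_ss r d \<longleftrightarrow> c \<in> abs_cycle ` cyc_lists 0 r d" for c
  proof (cases c rule: cycle_cases)
    case (1 a)
    have "b \<noteq> []" if "b \<in> cyc_lists 0 r d" for b using that by (auto simp: cyc_lists_def)
    then show ?thesis using mem_M_cyc_ss_iff 1 by (metis imageE imageI)
  qed
  then show ?thesis by blast
qed

lemma M_cyc_s_eq: "M_cyc_s r d = abs_cycle ` cyc_lists 1 r d"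
proof -
  have "c \<in> M_cyc_s r d \<longleftrightarrow> c \<in> abs_cycle ` cyc_lists 1 r d" for c
  proof (cases c rule: cycle_cases)
    case (1 a)
    have "b \<noteq> []" if "b \<in> cyc_lists 1 r d" for b using that by (auto simp: cyc_lists_def)
    then show ?thesis using mem_M_cyc_s_iff 1 by (metis imageE imageI)
  qed
  then show ?thesis by blast
qed


section \<open>The expansion map\<close>

lemma expand_Nil [simp]: "expand [] = []"
  by (simp add: expand_def)

lemma expand_Cons [simp]: "expand (x # c) = 1 # replicate (nat (- x)) 0 @ expand c"
  by (simp add: expand_def)

lemma expand_append [simp]: "expand (c @ c') = expand c @ expand c'"
  by (simp add: expand_def)

lemma expand_eq_Nil_iff [simp]: "expand c = [] \<longleftrightarrow> c = []"
  by (cases c) auto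

lemma hd_expand: "c \<noteq> [] \<Longrightarrow> hd (expand c) = 1"
  by (cases c) auto

lemma set_expand: "set (expand c) \<subseteq> {0, 1}"
  by (induction c) auto

lemma sum_list_expand: "sum_list (expand c) = int (length c)"
  by (induction c) (auto simp: sum_list_replicate)

lemma length_expand:
  "\<forall>x\<in>set c. x \<le> 0 \<Longrightarrow> int (length (expand c)) = int (length c) - sum_list c"
  by (induction c) auto

lemma replicate_append_Cons_eq_iff:
  assumes "x \<noteq> y"
  shows "replicate m x @ y # u = replicate n x @ y # v \<longleftrightarrow> m = n \<and> u = v"
proof (induction m arbitrary: n)
  case 0
  then show ?case using assms by (cases n) auto
next
  case (Suc m)
  then show ?case using assms by (cases n) auto
qed

section \<open>Expansions as an encoding of 0-1 words\<close>

text \<open>The lengths of the zero blocks recover the entries, provided these are nonpositive,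
  since \<open>nat (- x)\<close> collapses positive entries to 0. A closing 1 is appended so that
  the last block is delimited like all others.\<close>

lemma expand_inject:
  assumes "expand a = expand b" "\<forall>x\<in>set a. x \<le> 0" "\<forall>x\<in>set b. x \<le> 0"
  shows "a = b"
proof -
  have ends: "\<exists>u. expand c @ [1] = 1 # u" for c by (cases c) auto
  from assms show ?thesis
  proof (induction a arbitrary: b)
    case Nil
    then show ?case by (metis expand_Nil expand_eq_Nil_iff)
  next
    case (Cons x a)
    then obtain y b' where b: "b = y # b'" by (cases b) auto
    obtain u v where uv: "expand a @ [1] = 1 # u" "expand b' @ [1] = 1 # v"
      using ends by metis
    have "(replicate (nat (- x)) 0 @ expand a) @ [1] = (replicate (nat (- y)) 0 @ expand b') @ [1]"
      using Cons.prems(1) b by simp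
    then have "replicate (nat (- x)) 0 @ 1 # u = replicate (nat (- y)) 0 @ 1 # v"
      unfolding append_assoc uv .
    then have nuv: "nat (- x) = nat (- y)" "u = v"
      using replicate_append_Cons_eq_iff[of "0 :: int" 1] by simp_all
    have "expand a @ [1] = expand b' @ [1]" by (simp only: uv nuv(2))
    then have "expand a = expand b'" by simp
    moreover have "x \<le> 0" "y \<le> 0" using Cons.prems b by simp_all
    then have "x = y" using nuv(1) by linarith
    ultimately show ?case using Cons b by simp
  qed
qed

lemma expand_surj:
  assumes "set w \<subseteq> {0, 1}" "w \<noteq> []" "hd w = 1"
  obtains c where "\<forall>x\<in>set c. x \<le> 0" "w = expand c"
proof -
  \<comment> \<open>The induction adds letters on the left, so zeros may be waiting for the 1 that
    opens their block; \<open>n\<close> counts them.\<close>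
  have "\<exists>c n. (\<forall>x\<in>set c. x \<le> 0) \<and> w = replicate n 0 @ expand c" if "set w \<subseteq> {0, 1}" for w
    using that
  proof (induction w)
    case Nil
    show ?case by (intro exI[of _ "[]"] exI[of _ 0]) simp
  next
    case (Cons x w)
    then obtain c n where cn: "\<forall>x\<in>set c. x \<le> 0" "w = replicate n 0 @ expand c" by auto
    from Cons.prems consider "x = 0" | "x = 1" by auto
    then show ?case
    proof cases
      case 1
      then show ?thesis using cn by (intro exI[of _ c] exI[of _ "Suc n"]) simp
    next
      case 2
      then show ?thesis using cn by (intro exI[of _ "- int n # c"] exI[of _ 0]) simp
    qed
  qed
  from this[OF assms(1)] obtain c n where cn: "\<forall>x\<in>set c. x \<le> 0" "w = replicate n 0 @ expand c"
    by blast
  have "n = 0" using assms(2,3) cn(2) by (cases n) auto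
  then show thesis using that cn by simp
qed

section \<open>Subwords of an expansion\<close>

lemma sublist_expand:
  assumes "sublist e c"
  shows "sublist (expand e @ [1]) (expand c @ [1])"
proof -
  obtain p q where c: "c = p @ e @ q" using assms by (auto simp: sublist_def)
  \<comment> \<open>The 1 that closes \<open>expand e\<close> opens the next block, or is the final
    1 of the whole word when \<open>q\<close> is empty.\<close>
  have "prefix [1] (expand q @ [1])" by (cases q) auto
  then obtain v where "expand q @ [1] = [1] @ v" by (auto simp: prefix_def)
  then have "expand c @ [1] = expand p @ (expand e @ [1]) @ v" using c by simp
  then show ?thesis by (metis sublist_appendI)
qed

text \<open>The prefix starts with 1. The blocks completed before its last 1 make up
  \<open>expand e\<close>; that last 1 accounts for the \<open>+ 1\<close> in the length, and only
  zeros can follow it.\<close>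

lemma prefix_expand:
  assumes "prefix b (expand c @ [1])" "b \<noteq> []"
  shows "\<exists>e. prefix e c \<and> int (length e) = sum_list b - 1 \<and> length (expand e) + 1 \<le> length b"
  using assms
proof (induction c arbitrary: b)
  case Nil
  then show ?case by (auto simp: prefix_Cons)
next
  case (Cons x c)
  define z :: "int list" where "z = replicate (nat (- x)) 0"
  have "prefix b ((1 # z) @ (expand c @ [1]))" using Cons.prems(1) by (simp add: z_def)
  then consider "prefix b (1 # z)" | b' where "b = (1 # z) @ b'" "prefix b' (expand c @ [1])" "b' \<noteq> []"
    unfolding prefix_append by (metis append_Nil2 prefix_order.refl)
  then show ?case
  proof cases
    case 1
    then obtain b' where b: "b = 1 # b'" "prefix b' z" using Cons.prems(2) by (auto simp: prefix_Cons)
    then have "set b' \<subseteq> {0}" using set_mono_prefix[OF b(2)] by (auto simp: z_def)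
    then have "sum_list b' = 0" by (induction b') auto
    then show ?thesis using b by (intro exI[of _ "[]"]) simp
  next
    case 2
    obtain e where "prefix e c" "int (length e) = sum_list b' - 1" "length (expand e) + 1 \<le> length b'"
      using Cons.IH[OF 2(2,3)] by blast
    then show ?thesis
      using 2(1) by (intro exI[of _ "x # e"]) (auto simp: z_def sum_list_replicate)
  qed
qed

text \<open>Trimming leading and trailing zeros from a subword turns it into the expansion of a subword.\<close>

lemma sublist_expand_trim:
  assumes "sublist b (expand c @ [1])" "sum_list b \<ge> 2"
  shows "\<exists>e. sublist e c \<and> int (length e) = sum_list b - 1 \<and> length (expand e) + 1 \<le> length b"
  using assms
proof (induction c arbitrary: b)
  case Nil
  then have "b = [] \<or> b = [1]" by (auto simp: sublist_Cons_right prefix_Cons)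
  then show ?case using Nil(2) by auto
next
  case (Cons x c)
  define z :: "int list" where "z = replicate (nat (- x)) 0"
  have z0: "sum_list u = 0" if "set u \<subseteq> set z" for u
  proof -
    have "set u \<subseteq> {0}" using that by (auto simp: z_def split: if_splits)
    then show ?thesis by (induction u) auto
  qed
  have "sublist b (1 # z @ (expand c @ [1]))" using Cons.prems(1) by (simp add: z_def)
  then consider "prefix b (expand (x # c) @ [1])" | "sublist b (z @ (expand c @ [1]))"
    unfolding sublist_Cons_right by (auto simp: z_def)
  then show ?case
  proof cases
    case 1
    moreover have "b \<noteq> []" using Cons.prems(2) by auto
    ultimately show ?thesis using prefix_expand[of b "x # c"] prefix_imp_sublist by blast
  next
    case 2
    then consider "sublist b z" | "sublist b (expand c @ [1])"
      | b1 b2 where "b = b1 @ b2" "suffix b1 z" "prefix b2 (expand c @ [1])"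
      unfolding sublist_append by blast
    then show ?thesis
    proof cases
      case 1
      then have "sum_list b = 0" using z0 set_mono_sublist by blast
      then show ?thesis using Cons.prems(2) by simp
    next
      case 2
      then show ?thesis using Cons.IH[OF 2 Cons.prems(2)] by (auto simp: sublist_Cons_right)
    next
      case 3
      then have "sum_list b1 = 0" using z0 set_mono_suffix by blast
      then have s: "sum_list b2 = sum_list b" using 3 by simp
      then have "b2 \<noteq> []" using Cons.prems(2) by auto
      then obtain e where "prefix e c" "int (length e) = sum_list b - 1" "length (expand e) + 1 \<le> length b2"
        using prefix_expand[OF 3(3)] s by auto
      then show ?thesis using 3(1)
        by (intro exI[of _ e]) (auto simp: sublist_Cons_right)
    qed
  qed
qed

text \<open>
  If \<open>e\<close> has rank m and entry sum -K, the chain \<open>expand e @ [1]\<close> has rank m + K + 1 and degree m.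
\<close>

lemma slope_bound_expand:
  assumes "\<forall>x\<in>set e. x \<le> 0"
  shows "slope_bound t r d (expand e @ [1]) \<longleftrightarrow> slope_bound t d (d - r) e"
  by (simp add: slope_bound_def sum_list_expand length_expand[OF assms] algebra_simps)

text \<open>If \<open>b\<close> has two or more ones, trimming keeps its sum and does not lengthen
  it, so because \<open>d > 0\<close> the bound for the trimmed word is the harder one. Otherwise
  the degree is at most 0 and the right-hand side at least 1, which covers the margin
  \<open>t\<close>. The length restriction in \<open>bound\<close> lets properness of
  \<open>b\<close> pass to \<open>e\<close>.\<close>

lemma slope_bound_expand_trim:
  assumes b: "sublist b (expand c @ [1])" "b \<noteq> []" and c: "\<forall>x\<in>set c. x \<le> 0"
    and rd: "0 < d" "0 < r" "t \<le> 1"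
    and bound: "\<And>e. e \<noteq> [] \<Longrightarrow> sublist e c \<Longrightarrow> length (expand e) + 1 \<le> length b \<Longrightarrow>
      slope_bound t d (d - r) e"
  shows "slope_bound t r d b"
proof (cases "sum_list b \<ge> 2")
  case True
  then obtain e where e: "sublist e c" "int (length e) = sum_list b - 1"
      "length (expand e) + 1 \<le> length b"
    using sublist_expand_trim[OF b(1)] by blast
  then have "e \<noteq> []" using True by auto
  moreover have "\<forall>x\<in>set e. x \<le> 0" using set_mono_sublist[OF e(1)] c by blast
  ultimately have "slope_bound t r d (expand e @ [1])"
    using slope_bound_expand bound e by blast
  then have "r * (sum_list b - 1) + t \<le> d * int (length (expand e) + 1)"
    using e by (simp add: slope_bound_def sum_list_expand)
  also have "\<dots> \<le> d * int (length b)"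
    using e(3) rd by (intro mult_left_mono) linarith+
  finally show ?thesis by (simp add: slope_bound_def)
next
  case False
  have "length b \<ge> 1" using b(2) by (cases b) auto
  then have "d * int (length b) \<ge> 1 * 1" using rd by (intro mult_mono) auto
  moreover have "r * (sum_list b - 1) \<le> 0" using False rd by (intro mult_nonneg_nonpos) auto
  ultimately show ?thesis using rd(3) by (simp add: slope_bound_def)
qed

section \<open>Chains\<close>

lemma ch_proper_bound:
  assumes "a \<in> ch_lists t r d" "0 \<le> t" "sublist b a" "length b < length a"
  shows "r * (sum_list b - 1) \<le> d * int (length b)"
proof (cases "b = []")
  case True
  then show ?thesis using assms(1) by (auto simp: ch_lists_def)
next
  case False
  then have "slope_bound t r d b" using assms by (auto simp: ch_lists_def)
  then show ?thesis using assms(2) by (simp add: slope_bound_def)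
qed

lemma ch_entry_upper:
  assumes "a \<in> ch_lists t r d" "0 \<le> t" "x \<in> set a"
  shows "r * (x - 1) \<le> d"
proof (cases "length a = 1")
  case True
  then have "a = [x]" using assms(3) by (cases a) auto
  then show ?thesis using assms(1) by (auto simp: ch_lists_def)
next
  case False
  moreover have "length a > 0" using assms(3) by (cases a) auto
  ultimately have "1 < length a" by linarith
  then have "length [x] < length a" by simp
  moreover obtain p q where "a = p @ [x] @ q" using split_list[OF assms(3)] by auto
  then have "sublist [x] a" by (simp add: sublist_def) blast
  ultimately show ?thesis using ch_proper_bound[OF assms(1,2), of "[x]"] by simp
qed

text \<open>Upper bounds for the two pieces beside \<open>x\<close> give a lower bound for
  \<open>x\<close>. The pieces lose a 1 each while the total \<open>d + 1\<close> makes up for only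
  one of them, hence \<open>x + 1\<close>.\<close>

lemma ch_entry_lower:
  assumes a: "a \<in> ch_lists t r d" "0 \<le> t" "x \<in> set a"
  shows "d \<le> r * (x + 1)"
proof -
  obtain p q where pq: "a = p @ x # q" using split_list[OF assms(3)] by auto
  have "r * (sum_list p - 1) \<le> d * int (length p)" "r * (sum_list q - 1) \<le> d * int (length q)"
    by (rule ch_proper_bound[OF a(1,2)]; simp add: pq sublist_Cons_right sublist_append)+
  then have "r * (sum_list p + sum_list q - 2) \<le> d * (int (length p) + int (length q))"
    by (simp add: algebra_simps)
  moreover have "sum_list p + sum_list q = d + 1 - x" "int (length p) + int (length q) = r - 1"
    using a(1) pq by (auto simp: ch_lists_def)
  ultimately have "r * (d + 1 - x - 2) \<le> d * (r - 1)" by simp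
  then show ?thesis by (simp add: algebra_simps)
qed

text \<open>Beside an end entry there is a single piece, so the bound is sharper by \<open>r\<close>
  than for interior entries. For \<open>d > 0\<close> it excludes 0 at both ends.\<close>

lemma ch_end_lower:
  assumes a: "a \<in> ch_lists t r d" "0 \<le> t" and p: "a = x # p \<or> a = p @ [x]"
  shows "d \<le> r * x"
proof -
  have "sublist p a" "length p < length a" using p by (auto simp: sublist_Cons_right)
  then have "r * (sum_list p - 1) \<le> d * int (length p)" using ch_proper_bound[OF a] by blast
  moreover have "sum_list p = d + 1 - x" "int (length p) = r - 1"
    using a(1) p by (auto simp: ch_lists_def)
  ultimately have "r * (d + 1 - x - 1) \<le> d * (r - 1)" by simp
  then show ?thesis by (simp add: algebra_simps)
qed

lemma entry_zero_one:
  fixes r d x :: int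
  assumes "0 < d" "d < r" "r * (x - 1) \<le> d" "d \<le> r * (x + 1)"
  shows "x \<in> {0, 1}"
proof -
  have "r * (x - 1) < r * 1" "r * 0 < r * (x + 1)" using assms by linarith+
  then have "x - 1 < 1" "0 < x + 1"
    using assms by (simp_all only: mult_less_cancel_left_pos)
  then show ?thesis by auto
qed

lemma entry_nonpos:
  fixes r d x :: int
  assumes "0 < d" "d < r" "d * (x - 1) \<le> d - r"
  shows "x \<le> 0"
proof -
  have "d * (x - 1) < d * 0" using assms by simp
  then have "x - 1 < 0" using assms by (simp only: mult_less_cancel_left_pos)
  then show ?thesis by simp
qed

section \<open>Expansion of chains\<close>

lemma mem_ch_lists_expand_iff:
  assumes c: "c \<noteq> []" "\<forall>x\<in>set c. x \<le> 0" and rd: "0 < d" "d < r" "t \<le> 1"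
  shows "expand c @ [1] \<in> ch_lists t r d \<longleftrightarrow> c \<in> ch_lists t d (d - r)"
proof -
  have rank_deg: "int (length (expand c @ [1])) = r \<and> sum_list (expand c @ [1]) = d + 1 \<longleftrightarrow>
      int (length c) = d \<and> sum_list c = d - r + 1"
    using length_expand[OF c(2)] by (auto simp: sum_list_expand)
  have "(\<forall>b. b \<noteq> [] \<longrightarrow> sublist b (expand c @ [1]) \<longrightarrow> length b < length (expand c @ [1]) \<longrightarrow>
        slope_bound t r d b) \<longleftrightarrow>
      (\<forall>e. e \<noteq> [] \<longrightarrow> sublist e c \<longrightarrow> length e < length c \<longrightarrow> slope_bound t d (d - r) e)"
      (is "?L \<longleftrightarrow> ?R")
  proof (intro iffI allI impI)
    fix e assume L: ?L and e: "e \<noteq> []" "sublist e c" "length e < length c"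
    from e obtain p q where "c = p @ e @ q" "p \<noteq> [] \<or> q \<noteq> []" by (auto simp: sublist_def)
    \<comment> \<open>Every entry contributes at least its own 1, so properness survives
      expansion.\<close>
    then have "length (expand e) < length (expand c)" by (auto simp: zero_less_iff_neq_zero)
    then have "slope_bound t r d (expand e @ [1])"
      using L sublist_expand[OF e(2)] by simp
    moreover have "\<forall>x\<in>set e. x \<le> 0" using set_mono_sublist[OF e(2)] c(2) by blast
    ultimately show "slope_bound t d (d - r) e" using slope_bound_expand by blast
  next
    fix b assume R: ?R and b: "b \<noteq> []" "sublist b (expand c @ [1])" "length b < length (expand c @ [1])"
    show "slope_bound t r d b"
    proof (rule slope_bound_expand_trim[OF b(2,1) c(2)])
      fix e assume e: "e \<noteq> []" "sublist e c" "length (expand e) + 1 \<le> length b"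
      \<comment> \<open>Conversely, \<open>e = c\<close> would make \<open>b\<close> as long as the
        whole word.\<close>
      have "e \<noteq> c" using e(3) b(3) by auto
      then have "length e < length c" using sublist_full_length[OF e(2)] by blast
      then show "slope_bound t d (d - r) e" using R e by blast
    qed (use rd in auto)
  qed
  then show ?thesis using rank_deg c(1) unfolding ch_lists_def by blast
qed

lemma bij_betw_chain_expand:
  assumes rd: "0 < d" "d < r" and t: "0 \<le> t" "t \<le> 1"
  shows "bij_betw chain_expand (ch_lists t d (d - r)) (ch_lists t r d)"
proof -
  have neg: "\<forall>x\<in>set c. x \<le> 0" if "c \<in> ch_lists t d (d - r)" for c
    using ch_entry_upper[OF that t(1)] entry_nonpos[OF rd] by blast
  have ne: "c \<noteq> []" if "c \<in> ch_lists t d (d - r)" for c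
    using that by (auto simp: ch_lists_def)
  show ?thesis unfolding bij_betw_def
  proof (intro conjI inj_onI equalityI subsetI)
    fix a b assume "a \<in> ch_lists t d (d - r)" "b \<in> ch_lists t d (d - r)" "chain_expand a = chain_expand b"
    then show "a = b" using expand_inject neg by (simp add: chain_expand_def)
  next
    fix w assume "w \<in> chain_expand ` ch_lists t d (d - r)"
    then show "w \<in> ch_lists t r d"
      using mem_ch_lists_expand_iff neg ne rd t(2) by (auto simp: chain_expand_def)
  next
    fix w assume w: "w \<in> ch_lists t r d"
    have set: "set w \<subseteq> {0, 1}"
      using ch_entry_upper[OF w t(1)] ch_entry_lower[OF w t(1)] entry_zero_one[OF rd] by blast
    have len: "w \<noteq> []" "int (length w) = r" using w by (auto simp: ch_lists_def)
    have ends: "y = 1" if "w = y # p \<or> w = p @ [y]" for y p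
    proof -
      have "y \<in> {0, 1}" using set that by auto
      moreover have "y \<noteq> 0" using ch_end_lower[OF w t(1) that] rd by auto
      ultimately show ?thesis by simp
    qed
    obtain v y where v: "w = v @ [y]" using len(1) by (metis append_butlast_last_id)
    \<comment> \<open>From \<open>0 < d < r\<close> the rank is at least 2, so the opening and the
      closing 1 are different letters.\<close>
    have "v \<noteq> []" using len(2) rd v by auto
    then obtain z v' where z: "v = z # v'" by (cases v) auto
    have "y = 1" "z = 1" using ends v z by auto
    moreover have "set v \<subseteq> {0, 1}" using set v by auto
    ultimately obtain c where c: "\<forall>x\<in>set c. x \<le> 0" "v = expand c"
      using expand_surj[of v] z by auto
    then have "w = chain_expand c" using v \<open>y = 1\<close> by (simp add: chain_expand_def)
    moreover have "c \<noteq> []" using c z by auto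
    ultimately show "w \<in> chain_expand ` ch_lists t d (d - r)"
      using mem_ch_lists_expand_iff[OF _ c(1) rd t(2)] w by (auto simp: chain_expand_def)
  qed
qed

section \<open>Adding a constant to every entry\<close>

lemma sum_list_shift: "sum_list (map (\<lambda>x. x + k) b) = sum_list b + k * int (length b)"
  for k :: int
  by (induction b) (auto simp: algebra_simps)

text \<open>Both sides of the inequality grow by \<open>k * r * int (length b)\<close>.\<close>

lemma slope_bound_shift:
  "slope_bound t r (d + k * r) (map (\<lambda>x. x + k) b) \<longleftrightarrow> slope_bound t r d b"
  by (simp add: slope_bound_def sum_list_shift algebra_simps)

lemma sublist_mapE:
  assumes "sublist b (map f a)"
  obtains b' where "b = map f b'" "sublist b' a"
proof -
  obtain p q where "map f a = p @ (b @ q)" using assms by (auto simp: sublist_def)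
  then obtain u v where uv: "a = u @ v" "b @ q = map f v"
    using map_eq_append_conv[of f a p "b @ q"] by blast
  then obtain w z where "v = w @ z" "b = map f w"
    using map_eq_append_conv[of f v b q] by metis
  with uv(1) that show thesis by (auto simp: sublist_def)
qed

lemma ch_lists_shift:
  assumes "a \<in> ch_lists t r d"
  shows "map (\<lambda>x. x + k) a \<in> ch_lists t r (d + k * r)"
proof -
  have "slope_bound t r (d + k * r) b"
    if b: "b \<noteq> []" "sublist b (map (\<lambda>x. x + k) a)" "length b < length a" for b
  proof -
    obtain b' where "b = map (\<lambda>x. x + k) b'" "sublist b' a" using sublist_mapE[OF b(2)] .
    then show ?thesis using assms b by (auto simp: ch_lists_def slope_bound_shift)
  qed
  then show ?thesis using assms by (auto simp: ch_lists_def sum_list_shift)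
qed

lemma bij_betw_chain_twist: "bij_betw chain_twist (ch_lists t r d) (ch_lists t r (d + r))"
  by (rule bij_betw_byWitness[where f' = "map (\<lambda>x. x + (- 1))"])
    (use ch_lists_shift[of _ t r d 1] ch_lists_shift[of _ t r "d + r" "- 1"] in
      \<open>auto simp: chain_twist_def o_def\<close>)

section \<open>Cycles\<close>

text \<open>Counting repetitions instead of comparing lengths suits expansion, which alters lengths
  but not the number of repetitions.\<close>

lemma seq_aperiodic_iff:
  assumes "a \<noteq> []"
  shows "seq_aperiodic a \<longleftrightarrow> (\<nexists>b n. n \<ge> 2 \<and> a = concat (replicate n b))"
proof -
  have "length b < length a \<longleftrightarrow> n \<ge> 2" if "a = concat (replicate n b)" for b n
  proof -
    have "length a = n * length b" using that by (simp add: length_concat sum_list_replicate)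
    moreover have "length b > 0" using assms calculation by (cases b) auto
    ultimately show ?thesis by auto
  qed
  then show ?thesis unfolding seq_aperiodic_def by blast
qed

lemma expand_concat_replicate: "expand (concat (replicate n b)) = concat (replicate n (expand b))"
  by (induction n) auto

text \<open>A repeated unit of \<open>expand c\<close> starts with the same 1 as the whole word, so
  it is itself an expansion, and injectivity carries the repetition back to
  \<open>c\<close>.\<close>

lemma seq_aperiodic_expand:
  assumes c: "c \<noteq> []" "\<forall>x\<in>set c. x \<le> 0"
  shows "seq_aperiodic (expand c) \<longleftrightarrow> seq_aperiodic c"
proof -
  have "\<exists>e. c = concat (replicate n e)" if n: "n \<ge> 2" "expand c = concat (replicate n b)" for n b
  proof -
    obtain m where m: "n = Suc m" using n(1) by (cases n) auto
    have b: "b \<noteq> []" using n c(1) by (cases b) auto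
    then have "hd b = 1" using hd_expand[OF c(1)] n(2) m by simp
    moreover have "set b \<subseteq> {0, 1}" using set_expand[of c] n(2) m by auto
    ultimately obtain e where e: "\<forall>x\<in>set e. x \<le> 0" "b = expand e" using expand_surj b by blast
    then have "expand c = expand (concat (replicate n e))"
      using n(2) by (simp add: expand_concat_replicate)
    moreover have "\<forall>x\<in>set (concat (replicate n e)). x \<le> 0" using e(1) by auto
    ultimately show ?thesis using expand_inject c(2) by blast
  qed
  moreover have "expand c = concat (replicate n (expand e))" if "c = concat (replicate n e)" for n e
    using that expand_concat_replicate by simp
  ultimately show ?thesis using c(1) by (simp add: seq_aperiodic_iff) blast
qed

lemma cyc_entry_upper:
  assumes "a \<in> cyc_lists t r d" "0 \<le> t" "x \<in> set a"
  shows "r * (x - 1) \<le> d"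
proof -
  obtain p q where "a = p @ [x] @ q" using split_list[OF assms(3)] by auto
  then have "sublist [x] a" by (simp add: sublist_def) blast
  then have "sublist [x] (a @ a)" by (simp add: sublist_append)
  then have "slope_bound t r d [x]" using assms(1) by (auto simp: cyc_lists_def)
  then show ?thesis using assms(2) by (simp add: slope_bound_def)
qed

text \<open>On a cycle the complement of an entry is the single window \<open>q @ p\<close>, so ends
  and interior need no distinction; the total is now \<open>d\<close> rather than
  \<open>d + 1\<close>.\<close>

lemma cyc_entry_lower:
  assumes a: "a \<in> cyc_lists t r d" "0 \<le> t" "x \<in> set a"
  shows "d \<le> r * (x + 1)"
proof -
  obtain p q where pq: "a = p @ x # q" using split_list[OF assms(3)] by auto
  have "a @ a = (p @ [x]) @ (q @ p) @ (x # q)" using pq by simp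
  then have "sublist (q @ p) (a @ a)" by (metis sublist_appendI)
  then have "slope_bound t r d (q @ p) \<or> q @ p = []" using a(1) by (auto simp: cyc_lists_def)
  then have "r * (sum_list (q @ p) - 1) \<le> d * int (length (q @ p))"
    using a by (auto simp: slope_bound_def cyc_lists_def)
  moreover have "sum_list (q @ p) = d - x" "int (length (q @ p)) = r - 1"
    using a(1) pq by (auto simp: cyc_lists_def)
  ultimately have "r * (d - x - 1) \<le> d * (r - 1)" by simp
  then show ?thesis by (simp add: algebra_simps)
qed

lemma mem_cyc_lists_expand_iff:
  assumes c: "c \<noteq> []" "\<forall>x\<in>set c. x \<le> 0" and rd: "0 < d" "d < r" "t \<le> 1"
  shows "expand c \<in> cyc_lists t r d \<longleftrightarrow> c \<in> cyc_lists t d (d - r)"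
proof -
  have rank_deg: "int (length (expand c)) = r \<and> sum_list (expand c) = d \<longleftrightarrow>
      int (length c) = d \<and> sum_list c = d - r"
    using length_expand[OF c(2)] by (auto simp: sum_list_expand)
  have "(\<forall>b. b \<noteq> [] \<longrightarrow> sublist b (expand c @ expand c) \<longrightarrow> slope_bound t r d b) \<longleftrightarrow>
      (\<forall>e. e \<noteq> [] \<longrightarrow> sublist e (c @ c) \<longrightarrow> slope_bound t d (d - r) e)"
      (is "?L \<longleftrightarrow> ?R")
    if eqs: "int (length c) = d" "sum_list c = d - r"
  proof (intro iffI allI impI)
    fix e assume L: ?L and e: "e \<noteq> []" "sublist e (c @ c)"
    show "slope_bound t d (d - r) e"
    proof (rule slope_bound_double[OF c(1) eqs rd(3) _ e])
      fix e assume e: "e \<noteq> []" "sublist e (c @ c)" "length e < length c"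
      text \<open>The closing 1 is the first letter after \<open>e\<close>, so \<open>e\<close> must not end the word \<open>c @ c\<close>.\<close>
      have "\<exists>p q. c @ c = p @ e @ q \<and> q \<noteq> []"
      proof -
        obtain p q where pq: "c @ c = p @ e @ q" using e(2) by (auto simp: sublist_def)
        show ?thesis
        proof (cases "q = []")
          case True
          \<comment> \<open>A short window at the very end of \<open>c @ c\<close> also ends the
            first copy of \<open>c\<close>, where the second copy follows it.\<close>
          then have "suffix e c" using pq e(3) by (metis append_Nil2 suffixI suffix_length_suffix less_imp_le)
          then obtain p' where "c = p' @ e" by (auto simp: suffix_def)
          then have "c @ c = p' @ e @ c" by simp
          then show ?thesis using c(1) by blast
        qed (use pq in blast)
      qed
      then obtain p q where pq: "c @ c = p @ e @ q" "q \<noteq> []" by blast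
      then obtain y q' where "q = y # q'" by (cases q) auto
      then have "expand (c @ c) = expand p @ (expand e @ [1]) @ (replicate (nat (- y)) 0 @ expand q')"
        unfolding pq(1) by simp
      then have "sublist (expand e @ [1]) (expand c @ expand c)"
        by (metis sublist_appendI expand_append)
      then have "slope_bound t r d (expand e @ [1])" using L by blast
      moreover have "\<forall>x\<in>set e. x \<le> 0" using set_mono_sublist[OF e(2)] c(2) by auto
      ultimately show "slope_bound t d (d - r) e" using slope_bound_expand by blast
    qed
  next
    fix b assume R: ?R and b: "b \<noteq> []" "sublist b (expand c @ expand c)"
    \<comment> \<open>Since \<open>cyc_lists\<close> bounds subwords of \<open>c @ c\<close> of
      every length, the trimming argument applies to the doubled word just as to a chain.\<close>
    have "sublist b (expand (c @ c) @ [1])" using b(2) by (simp add: sublist_append flip: append_assoc)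
    then show "slope_bound t r d b"
      by (rule slope_bound_expand_trim[OF _ b(1)]) (use rd c(2) R in auto)
  qed
  then show ?thesis using rank_deg c seq_aperiodic_expand[OF c] unfolding cyc_lists_def by auto
qed

lemma cyc_lists_nonempty: "a \<in> cyc_lists t r d \<Longrightarrow> a \<noteq> []"
  by (simp add: cyc_lists_def)

section \<open>Passing from words to cycles\<close>

text \<open>For the margins 0 and 1 membership means that the cycle \<open>abs_cycle a\<close> is
  semistable or stable, so rotation invariance comes from the quotient.\<close>

lemma cyc_lists_rotate:
  assumes "t = 0 \<or> t = 1" "a \<in> cyc_lists t r d"
  shows "rotate n a \<in> cyc_lists t r d"
proof -
  have a: "a \<noteq> []" "rotate n a \<noteq> []" using assms(2) by (auto simp: cyc_lists_def)
  then have "abs_cycle a = abs_cycle (rotate n a)" using abs_cycle_eq_iff by blast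
  then show ?thesis using mem_M_cyc_ss_iff mem_M_cyc_s_iff a assms by metis
qed

text \<open>Allows bijections of cycles to be checked on representatives, with injectivity and
  surjectivity required only up to rotation.\<close>

lemma bij_betw_abs_cycle:
  assumes F: "\<And>a. a \<noteq> [] \<Longrightarrow> F (abs_cycle a) = abs_cycle (f a)"
    and ne: "\<And>a. a \<in> A \<Longrightarrow> a \<noteq> []" "\<And>b. b \<in> B \<Longrightarrow> b \<noteq> []"
    and into: "\<And>a. a \<in> A \<Longrightarrow> f a \<in> B"
    and inj: "\<And>a a' n. a \<in> A \<Longrightarrow> a' \<in> A \<Longrightarrow> f a' = rotate n (f a) \<Longrightarrow> \<exists>m. a' = rotate m a"
    and surj: "\<And>b. b \<in> B \<Longrightarrow> \<exists>a\<in>A. \<exists>n. b = rotate n (f a)"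
  shows "bij_betw F (abs_cycle ` A) (abs_cycle ` B)"
  unfolding bij_betw_def
proof (intro conjI inj_onI equalityI subsetI)
  fix c c' assume "c \<in> abs_cycle ` A" "c' \<in> abs_cycle ` A" "F c = F c'"
  then obtain a a' where a: "a \<in> A" "c = abs_cycle a" "a' \<in> A" "c' = abs_cycle a'"
      "abs_cycle (f a) = abs_cycle (f a')"
    using F ne by auto
  then obtain n where "f a' = rotate n (f a)"
    using abs_cycle_eq_iff[of "f a" "f a'"] into ne(2) by blast
  then show "c = c'" using inj a abs_cycle_eq_iff ne(1) by metis
next
  fix c assume "c \<in> F ` abs_cycle ` A"
  then show "c \<in> abs_cycle ` B" using F ne into by auto
next
  fix c assume "c \<in> abs_cycle ` B"
  then obtain b where b: "b \<in> B" "c = abs_cycle b" by blast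
  then obtain a n where a: "a \<in> A" "b = rotate n (f a)" using surj by blast
  then have "abs_cycle (f a) = abs_cycle b" using abs_cycle_eq_iff into ne(2) b(1) by blast
  then have "c = F (abs_cycle a)" using F ne(1) a b by simp
  then show "c \<in> F ` abs_cycle ` A" using a by blast
qed

text \<open>Both words start with 1, so a nontrivial rotation cuts \<open>expand c\<close> just
  before a 1. The two pieces are then expansions, and the cut comes from a cut of
  \<open>c\<close>.\<close>

lemma expand_rotate_inject:
  assumes eq: "expand c' = rotate n (expand c)" and neg: "\<forall>x\<in>set c. x \<le> 0" "\<forall>x\<in>set c'. x \<le> 0"
  shows "\<exists>m. c' = rotate m c"
proof (cases "c = []")
  case True
  then show ?thesis using eq by simp
next
  case False
  define u v where "u = take (n mod length (expand c)) (expand c)"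
    and "v = drop (n mod length (expand c)) (expand c)"
  have uv: "expand c = u @ v" "expand c' = v @ u"
    by (simp_all add: u_def v_def eq rotate_drop_take)
  have "v \<noteq> []" using False by (simp add: v_def not_le)
  show ?thesis
  proof (cases "u = []")
    case True
    then have "c' = c" using expand_inject uv neg by auto
    then show ?thesis by (intro exI[of _ 0]) simp
  next
    case u: False
    have "c' \<noteq> []" using \<open>v \<noteq> []\<close> uv(2) by auto
    then have hds: "hd u = 1" "hd v = 1"
      using hd_expand[OF False] hd_expand[of c'] uv u \<open>v \<noteq> []\<close> by auto
    have "set u \<subseteq> {0, 1}" "set v \<subseteq> {0, 1}" using set_expand[of c] uv(1) by auto
    note sets = this
    obtain p where p: "\<forall>x\<in>set p. x \<le> 0" "u = expand p"
      using expand_surj[OF sets(1) u hds(1)] by blast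
    obtain q where q: "\<forall>x\<in>set q. x \<le> 0" "v = expand q"
      using expand_surj[OF sets(2) \<open>v \<noteq> []\<close> hds(2)] by blast
    have "c = p @ q"
      by (rule expand_inject) (use uv(1) p q neg in auto)
    moreover have "c' = q @ p"
      by (rule expand_inject) (use uv(2) p q neg in auto)
    ultimately show ?thesis by (metis rotate_append)
  qed
qed

lemma bij_betw_cyc_expand:
  assumes rd: "0 < d" "d < r" and t: "t = 0 \<or> t = 1"
  shows "bij_betw cyc_expand (abs_cycle ` cyc_lists t d (d - r)) (abs_cycle ` cyc_lists t r d)"
proof -
  have t': "0 \<le> t" "t \<le> 1" using t by auto
  have neg: "\<forall>x\<in>set c. x \<le> 0" if "c \<in> cyc_lists t d (d - r)" for c
    using cyc_entry_upper[OF that t'(1)] entry_nonpos[OF rd] by blast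
  show ?thesis
  proof (rule bij_betw_abs_cycle[where f = expand])
    show "cyc_expand (abs_cycle a) = abs_cycle (expand a)" if "a \<noteq> []" for a
      by (rule cyc_expand.abs_eq[OF cyc_eq_refl[OF that]])
    show "expand a \<in> cyc_lists t r d" if "a \<in> cyc_lists t d (d - r)" for a
      using mem_cyc_lists_expand_iff[OF cyc_lists_nonempty[OF that] neg[OF that] rd t'(2)] that by blast
    show "\<exists>m. a' = rotate m a" if "a \<in> cyc_lists t d (d - r)" "a' \<in> cyc_lists t d (d - r)"
      "expand a' = rotate n (expand a)" for a a' n
      using expand_rotate_inject that neg by blast
    show "\<exists>a\<in>cyc_lists t d (d - r). \<exists>n. w = rotate n (expand a)" if w: "w \<in> cyc_lists t r d" for w
    proof -
      have set: "set w \<subseteq> {0, 1}"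
        using cyc_entry_upper[OF w t'(1)] cyc_entry_lower[OF w t'(1)] entry_zero_one[OF rd] by blast
      \<comment> \<open>Positive degree forces some 1; rotating it to the front yields a
        representative that is an expansion.\<close>
      have "1 \<in> set w"
      proof (rule ccontr)
        assume "1 \<notin> set w"
        then have "set w \<subseteq> {0}" using set by auto
        then have "sum_list w = 0" by (induction w) auto
        then show False using w rd by (simp add: cyc_lists_def)
      qed
      then obtain p q where pq: "w = p @ 1 # q" using split_list by metis
      define v where "v = 1 # q @ p"
      have v: "v = rotate (length p) w" "w = rotate (length (1 # q)) v"
        using rotate_append[of p "1 # q"] rotate_append[of "1 # q" p] by (simp_all add: pq v_def)
      have "set v \<subseteq> {0, 1}" "v \<noteq> []" "hd v = 1" using set by (auto simp: v_def pq)
      then obtain c where c: "\<forall>x\<in>set c. x \<le> 0" "v = expand c" using expand_surj by blast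
      have "c \<noteq> []" using c(2) by (auto simp: v_def)
      moreover have "v \<in> cyc_lists t r d" using cyc_lists_rotate[OF t w] v(1) by blast
      ultimately have "c \<in> cyc_lists t d (d - r)"
        using mem_cyc_lists_expand_iff[OF _ c(1) rd t'(2)] c(2) by blast
      then show ?thesis using v(2) c(2) by blast
    qed
  qed (auto simp: cyc_lists_def)
qed

lemma seq_aperiodic_shift:
  assumes "seq_aperiodic a"
  shows "seq_aperiodic (map (\<lambda>x. x + k) a)"
  unfolding seq_aperiodic_def
proof
  assume "\<exists>b n. length b < length (map (\<lambda>x. x + k) a) \<and> map (\<lambda>x. x + k) a = concat (replicate n b)"
  then obtain b n where b: "length b < length a" "map (\<lambda>x. x + k) a = concat (replicate n b)" by auto
  have "a = map (\<lambda>x. x - k) (map (\<lambda>x. x + k) a)" by (simp add: o_def)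
  also have "\<dots> = concat (replicate n (map (\<lambda>x. x - k) b))"
    unfolding b(2) by (simp add: map_concat)
  finally show False using assms b(1) unfolding seq_aperiodic_def by (metis length_map)
qed

lemma cyc_lists_shift:
  assumes "a \<in> cyc_lists t r d"
  shows "map (\<lambda>x. x + k) a \<in> cyc_lists t r (d + k * r)"
proof -
  have "slope_bound t r (d + k * r) b"
    if b: "b \<noteq> []" "sublist b (map (\<lambda>x. x + k) a @ map (\<lambda>x. x + k) a)" for b
  proof -
    obtain b' where "b = map (\<lambda>x. x + k) b'" "sublist b' (a @ a)"
      using b(2) sublist_mapE unfolding map_append[symmetric] by metis
    then show ?thesis using assms b by (auto simp: cyc_lists_def slope_bound_shift)
  qed
  then show ?thesis using assms by (auto simp: cyc_lists_def sum_list_shift seq_aperiodic_shift)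
qed

lemma bij_betw_cyc_twist:
  "bij_betw cyc_twist (abs_cycle ` cyc_lists t r d) (abs_cycle ` cyc_lists t r (d + r))"
proof (rule bij_betw_abs_cycle[where f = "map (\<lambda>x. x + 1)"])
  show "cyc_twist (abs_cycle a) = abs_cycle (map (\<lambda>x. x + 1) a)" if "a \<noteq> []" for a
    by (rule cyc_twist.abs_eq[OF cyc_eq_refl[OF that]])
  show "map (\<lambda>x. x + 1) a \<in> cyc_lists t r (d + r)" if "a \<in> cyc_lists t r d" for a
    using cyc_lists_shift[OF that, of 1] by simp
  show "\<exists>m. a' = rotate m a" if "map (\<lambda>x. x + 1) a' = rotate n (map (\<lambda>x. x + 1) a)" for a a' :: "int list" and n
  proof -
    have "map (\<lambda>x. x + 1) a' = map (\<lambda>x. x + 1) (rotate n a)" using that by (simp add: rotate_map)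
    then have "a' = rotate n a" by (rule map_injective) (simp add: inj_def)
    then show ?thesis by blast
  qed
  show "\<exists>a\<in>cyc_lists t r d. \<exists>n. b = rotate n (map (\<lambda>x. x + 1) a)" if "b \<in> cyc_lists t r (d + r)" for b
  proof -
    have "map (\<lambda>x. x + (- 1)) b \<in> cyc_lists t r d" using cyc_lists_shift[OF that, of "- 1"] by simp
    moreover have "b = rotate 0 (map (\<lambda>x. x + 1) (map (\<lambda>x. x + (- 1)) b))" by (simp add: o_def)
    ultimately show ?thesis by blast
  qed
qed (auto simp: cyc_lists_def)

section \<open>The Euclidean algorithm\<close>

text \<open>Recursion on the rank: twists replace \<open>d\<close> by its remainder
  \<open>m\<close>, and a nonzero \<open>m\<close> leads to the pair \<open>(m, m - r)\<close> of
  smaller rank and equal gcd. The family \<open>M\<close> is arbitrary so that all four cases are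
  covered.\<close>

lemma eqpoll_gcd:
  fixes M :: "int \<Rightarrow> int \<Rightarrow> 'a set"
  assumes twist: "\<And>r d. r > 0 \<Longrightarrow> M r d \<approx> M r (d + r)"
    and expand: "\<And>r d. 0 < d \<Longrightarrow> d < r \<Longrightarrow> M d (d - r) \<approx> M r d"
    and "r > 0"
  shows "M r d \<approx> M (gcd r d) 0"
  using \<open>r > 0\<close>
proof (induction "nat r" arbitrary: r d rule: less_induct)
  case less
  have twists: "M r d \<approx> M r (d + int k * r)" for d k
  proof (induction k)
    case (Suc k)
    have "M r (d + int k * r) \<approx> M r (d + int k * r + r)" using twist less.prems by blast
    then show ?case using eqpoll_trans[OF Suc] by (simp add: algebra_simps)
  qed simp
  have mod: "M r d \<approx> M r (d mod r)"
  \<comment> \<open>Twists only raise the degree, so the sign of the quotient decides whether to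
    climb from the remainder to \<open>d\<close> or from \<open>d\<close> to the remainder.\<close>
  proof (cases "d div r \<ge> 0")
    case True
    then have "d mod r + int (nat (d div r)) * r = d" by simp
    then show ?thesis using twists[of "d mod r" "nat (d div r)"] eqpoll_sym by metis
  next
    case False
    then have "d + int (nat (- (d div r))) * r = d mod r" by (simp add: minus_div_mult_eq_mod)
    then show ?thesis using twists[of d "nat (- (d div r))"] by metis
  qed
  define m where "m = d mod r"
  have m: "0 \<le> m" "m < r" using less.prems by (simp_all add: m_def)
  have g: "gcd r d = gcd r m" unfolding m_def by (metis gcd.commute gcd_red_int)
  show ?case
  proof (cases "m = 0")
    case True
    then show ?thesis using mod less.prems g by (simp add: m_def)
  next
    case False
    then have "m > 0" using m by simp
    have "gcd m (m - r) = gcd m r" by (metis gcd.commute gcd_diff2)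
    then have "M m (m - r) \<approx> M (gcd r m) 0"
      using less.hyps[of m "m - r"] m \<open>m > 0\<close> by (simp add: gcd.commute)
    moreover have "M r m \<approx> M m (m - r)" using expand \<open>m > 0\<close> m(2) eqpoll_sym by blast
    ultimately show ?thesis using mod g unfolding m_def[symmetric] by (metis eqpoll_trans)
  qed
qed

text \<open>Finiteness, emptiness and having one element pass along equipollence. Equality of the
  two sets does not, but it follows from an inclusion between singletons.\<close>

lemma euclidean_families:
  fixes Ms Mss :: "int \<Rightarrow> int \<Rightarrow> 'a set"
  assumes gcd_ss: "Mss r d \<approx> Mss (gcd r d) 0" and gcd_s: "Ms r d \<approx> Ms (gcd r d) 0"
    and sub: "Ms r d \<subseteq> Mss r d"
    and one: "Mss 1 0 = {x}" "Ms 1 0 = {x}"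
    and ss: "\<And>h. h > 0 \<Longrightarrow> finite (Mss h 0) \<and> Mss h 0 \<noteq> {}"
    and s: "\<And>h. h > 1 \<Longrightarrow> Ms h 0 = {}"
    and "r > 0"
  shows "finite (Mss r d) \<and> Mss r d \<noteq> {}
      \<and> (coprime r d \<longrightarrow> Ms r d = Mss r d \<and> (\<exists>!a. a \<in> Mss r d))
      \<and> (\<not> coprime r d \<longrightarrow> Ms r d = {})"
proof (intro conjI impI)
  have g: "gcd r d > 0" using \<open>r > 0\<close> by simp
  show "finite (Mss r d)" using eqpoll_finite_iff[OF gcd_ss] ss[OF g] by blast
  show "Mss r d \<noteq> {}" using gcd_ss ss[OF g] by (auto dest: eqpoll_sym)
  {
    assume "coprime r d"
    then have "gcd r d = 1" by (simp add: coprime_iff_gcd_eq_1)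
    then obtain u v where "Mss r d = {u}" "Ms r d = {v}"
      using gcd_ss gcd_s one by (auto simp: eqpoll_singleton_iff)
    then show "Ms r d = Mss r d" "\<exists>!a. a \<in> Mss r d" using sub by auto
  }
  assume "\<not> coprime r d"
  then have "gcd r d \<noteq> 1" by (simp add: coprime_iff_gcd_eq_1)
  then have "gcd r d > 1" using g by linarith
  then show "Ms r d = {}" using gcd_s s by auto
qed

section \<open>Degree zero\<close>

lemma ch_lists_rank_one: "ch_lists t 1 0 = {[1]}"
  by (auto simp: ch_lists_def length_Suc_conv)

lemma seq_aperiodic_singleton: "seq_aperiodic [x]"
  by (auto simp: seq_aperiodic_def)

lemma cyc_lists_rank_one:
  assumes "t \<le> 1"
  shows "cyc_lists t 1 0 = {[0]}"
proof -
  have "slope_bound t 1 0 b" if "b \<noteq> []" "sublist b [0, 0]" for b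
  proof -
    have "set b \<subseteq> {0}" using set_mono_sublist[OF that(2)] by auto
    then have "sum_list b = 0" by (induction b) auto
    then show ?thesis using assms by (simp add: slope_bound_def)
  qed
  then have "[0] \<in> cyc_lists t 1 0"
    by (simp add: cyc_lists_def seq_aperiodic_singleton)
  moreover have "a = [0]" if "a \<in> cyc_lists t 1 0" for a
  proof -
    have "length a = 1" "sum_list a = 0" using that by (simp_all add: cyc_lists_def)
    then show ?thesis by (cases a) simp_all
  qed
  ultimately show ?thesis by blast
qed

section \<open>No stable objects of degree 0 in rank above 1\<close>

text \<open>Single entries are proper subchains, so stability makes them nonpositive, whereas degree
  0 of a chain requires the sum 1.\<close>

lemma ch_lists_stable_empty:
  assumes "h > 1"
  shows "ch_lists 1 h 0 = {}"
proof -
  have False if a: "a \<in> ch_lists 1 h 0" for a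
  proof -
    have "x \<le> 0" if x: "x \<in> set a" for x
    proof -
      obtain p q where "a = p @ [x] @ q" using split_list[OF x] by auto
      then have "sublist [x] a" by (simp add: sublist_def) blast
      moreover have "length [x] < length a" using a assms by (auto simp: ch_lists_def)
      ultimately have "slope_bound 1 h 0 [x]" using a by (auto simp: ch_lists_def)
      then have "h * (x - 1) < h * 0" by (simp add: slope_bound_def)
      then have "x - 1 < 0" using assms by (simp only: mult_less_cancel_left_pos)
      then show ?thesis by simp
    qed
    then have "sum_list a \<le> 0" by (rule sum_list_nonpos)
    then show False using a by (simp add: ch_lists_def)
  qed
  then show ?thesis by blast
qed

text \<open>Again all entries are nonpositive. The sum 0 then makes them vanish, and a zero word of
  length at least 2 is periodic.\<close>

lemma cyc_lists_stable_empty: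
  assumes "h > 1"
  shows "cyc_lists 1 h 0 = {}"
proof -
  have False if a: "a \<in> cyc_lists 1 h 0" for a
  proof -
    have nonpos: "x \<le> 0" if x: "x \<in> set a" for x
    proof -
      obtain p q where "a = p @ [x] @ q" using split_list[OF x] by auto
      then have "sublist [x] a" by (simp add: sublist_def) blast
      then have "sublist [x] (a @ a)" by (simp add: sublist_append)
      then have "slope_bound 1 h 0 [x]" using a by (auto simp: cyc_lists_def)
      then have "h * (x - 1) < h * 0" by (simp add: slope_bound_def)
      then have "x - 1 < 0" using assms by (simp only: mult_less_cancel_left_pos)
      then show ?thesis by simp
    qed
    have "x = 0" if x: "x \<in> set a" for x
    proof -
      obtain p q where pq: "a = p @ x # q" using split_list[OF x] by auto
      have "sum_list (p @ q) \<le> 0" by (rule sum_list_nonpos) (use nonpos pq in auto)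
      moreover have "sum_list a = 0" using a by (simp add: cyc_lists_def)
      ultimately show ?thesis using nonpos[OF x] pq by simp
    qed
    then have "a = replicate (length a) 0" by (simp add: replicate_length_same)
    then have "a = concat (replicate (length a) [0])" by simp
    moreover have "a \<noteq> []" "length a \<ge> 2" "seq_aperiodic a"
      using a assms by (auto simp: cyc_lists_def)
    ultimately show False using seq_aperiodic_iff by blast
  qed
  then show ?thesis by blast
qed

section \<open>Finiteness and existence in degree 0\<close>

lemma finite_bounded_lists: "finite {a :: int list. set a \<subseteq> {- 1..1} \<and> int (length a) = h}"
proof -
  have "{a :: int list. set a \<subseteq> {- 1..1} \<and> int (length a) = h} \<subseteq>
      {a. set a \<subseteq> {- 1..1} \<and> length a = nat h}" by auto
  then show ?thesis using finite_lists_length_eq[of "{- 1..1 :: int}" "nat h"] finite_subset by blast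
qed

lemma degree_zero_entry:
  fixes h x :: int
  assumes "h > 0" "h * (x - 1) \<le> 0" "0 \<le> h * (x + 1)"
  shows "x \<in> {- 1..1}"
  using assms by (auto simp: mult_le_0_iff zero_le_mult_iff)

lemma finite_ch_lists: "h > 0 \<Longrightarrow> finite (ch_lists 0 h 0)"
proof (rule finite_subset[OF _ finite_bounded_lists[of h]], rule subsetI)
  fix a assume "h > 0" "a \<in> ch_lists 0 h 0"
  then show "a \<in> {a. set a \<subseteq> {- 1..1} \<and> int (length a) = h}"
    using degree_zero_entry ch_entry_upper[of a 0 h 0] ch_entry_lower[of a 0 h 0]
    by (auto simp: ch_lists_def subset_iff)
qed

lemma finite_cyc_lists: "h > 0 \<Longrightarrow> finite (cyc_lists 0 h 0)"
proof (rule finite_subset[OF _ finite_bounded_lists[of h]], rule subsetI)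
  fix a assume "h > 0" "a \<in> cyc_lists 0 h 0"
  then show "a \<in> {a. set a \<subseteq> {- 1..1} \<and> int (length a) = h}"
    using degree_zero_entry cyc_entry_upper[of a 0 h 0] cyc_entry_lower[of a 0 h 0]
    by (auto simp: cyc_lists_def subset_iff)
qed

lemma ch_lists_degree_zero_nonempty:
  assumes "h > 0"
  shows "ch_lists 0 h 0 \<noteq> {}"
proof -
  \<comment> \<open>Nonnegative entries of total 1: every subword has sum at most 1, hence degree at
    most 0.\<close>
  define a where "a = (1 :: int) # replicate (nat h - 1) 0"
  have "slope_bound 0 h 0 b" if b: "sublist b a" for b
  proof -
    obtain p q where pq: "a = p @ b @ q" using b by (auto simp: sublist_def)
    have "set a \<subseteq> {0, 1}" by (auto simp: a_def)
    then have "\<forall>x\<in>set (p @ b @ q). 0 \<le> x" using pq by force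
    then have "sum_list p \<ge> 0" "sum_list q \<ge> 0" by (simp_all add: sum_list_nonneg)
    moreover have "sum_list a = 1" by (simp add: a_def sum_list_replicate)
    ultimately have "sum_list b \<le> 1" using pq by simp
    then show ?thesis using assms by (simp add: slope_bound_def mult_le_0_iff)
  qed
  then have "a \<in> ch_lists 0 h 0"
    using assms by (auto simp: ch_lists_def a_def sum_list_replicate)
  then show ?thesis by blast
qed

text \<open>The partial sums run 0, 1, 0, 0, ... and return to 0 before \<open>ys\<close> begins.
  Taking \<open>ys\<close> empty and then a second copy of the word handles the doubled
  word.\<close>

lemma prefix_sums_bounded:
  assumes "prefix p ((1 # - 1 # replicate m 0) @ ys)"
    and ys: "\<And>q. prefix q ys \<Longrightarrow> sum_list q \<in> {0, 1 :: int}"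
  shows "sum_list p \<in> {0, 1}"
proof -
  have zeros: "sum_list p \<in> {0, 1}" if "prefix p (replicate m 0 @ ys)" for p
    using that
  proof (induction m arbitrary: p)
    case 0
    then show ?case using ys by simp
  next
    case (Suc m)
    from Suc.prems consider "p = []" | q where "p = 0 # q" "prefix q (replicate m 0 @ ys)"
      by (auto simp: prefix_Cons)
    then show ?case
    proof cases
      case 2
      then show ?thesis using Suc.IH[OF 2(2)] by simp
    qed simp
  qed
  from assms(1) consider "p = []" | "p = [1]"
    | q where "p = 1 # - 1 # q" "prefix q (replicate m 0 @ ys)"
    by (auto simp: prefix_Cons)
  then show ?thesis
  proof cases
    case 3
    then show ?thesis using zeros[OF 3(2)] by simp
  qed simp_all
qed

lemma cyc_lists_degree_zero_nonempty:
  assumes "h > 0"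
  shows "cyc_lists 0 h 0 \<noteq> {}"
proof (cases "h = 1")
  case True
  then show ?thesis using cyc_lists_rank_one[of 0] by simp
next
  case False
  \<comment> \<open>A subword sum is a difference of two prefix sums, so prefix sums in {0, 1} keep
    it at most 1. The word has two nonzero entries, so rank 1 is treated separately.\<close>
  define a where "a = (1 :: int) # - 1 # replicate (nat h - 2) 0"
  have pre1: "sum_list p \<in> {0, 1}" if "prefix p a" for p
    using prefix_sums_bounded[of p "nat h - 2" "[]"] that by (simp add: a_def)
  have pre: "sum_list p \<in> {0, 1}" if "prefix p (a @ a)" for p
    using prefix_sums_bounded[of p "nat h - 2" a] that pre1 unfolding a_def by blast
  have "slope_bound 0 h 0 b" if b: "sublist b (a @ a)" for b
  proof -
    obtain p q where pq: "a @ a = p @ b @ q" using b by (auto simp: sublist_def)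
    then have "prefix p (a @ a)" "prefix (p @ b) (a @ a)" by (auto simp: prefix_def)
    then have "sum_list p \<in> {0, 1}" "sum_list (p @ b) \<in> {0, 1}" using pre by blast+
    then have "sum_list b \<le> 1" by auto
    then show ?thesis using assms by (simp add: slope_bound_def mult_le_0_iff)
  qed
  moreover have "seq_aperiodic a"
  proof -
    \<comment> \<open>Each copy of the repeated word would start with 1, but 1 occurs only once in
      \<open>a\<close>.\<close>
    have False if n: "n \<ge> 2" and eq: "a = concat (replicate n b)" for n b
    proof -
      obtain m where m: "n = Suc (Suc m)" using n by (auto simp: numeral_2_eq_2 dest: Suc_le_D)
      then have abb: "a = b @ b @ concat (replicate m b)" using eq by simp
      have "b \<noteq> []"
      proof
        assume "b = []"
        then have "a = []" using eq by simp
        then show False by (simp add: a_def)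
      qed
      then have "hd b = hd a" by (simp add: abb)
      then have "hd b = 1" by (simp add: a_def)
      then have "count_list b 1 \<ge> 1" using \<open>b \<noteq> []\<close> by (cases b) auto
      moreover have "count_list a 1 = count_list b 1 + count_list b 1 + count_list (concat (replicate m b)) 1"
        by (subst abb) simp
      moreover have "count_list (replicate k 0) (1 :: int) = 0" for k by (induction k) auto
      ultimately show False by (simp add: a_def)
    qed
    then show ?thesis using seq_aperiodic_iff[of a] by (auto simp: a_def)
  qed
  ultimately have "a \<in> cyc_lists 0 h 0"
    using assms False by (auto simp: cyc_lists_def a_def sum_list_replicate)
  then show ?thesis by blast
qed

theorem theorem1p2:
  fixes r d :: int
  assumes r_pos: "r > 0"
  shows
    "(bij_betw chain_twist (M_ch_ss r d) (M_ch_ss r (d + r))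
      \<and> (0 < d \<and> d < r \<longrightarrow> bij_betw chain_expand (M_ch_ss d (d - r)) (M_ch_ss r d))
      \<and> (\<exists>f. bij_betw f (M_ch_ss r d) (M_ch_ss (gcd r d) 0)))
   \<and> (bij_betw chain_twist (M_ch_s r d) (M_ch_s r (d + r))
      \<and> (0 < d \<and> d < r \<longrightarrow> bij_betw chain_expand (M_ch_s d (d - r)) (M_ch_s r d))
      \<and> (\<exists>f. bij_betw f (M_ch_s r d) (M_ch_s (gcd r d) 0)))
   \<and> (bij_betw cyc_twist (M_cyc_s r d) (M_cyc_s r (d + r))
      \<and> (0 < d \<and> d < r \<longrightarrow> bij_betw cyc_expand (M_cyc_s d (d - r)) (M_cyc_s r d))
      \<and> (\<exists>f. bij_betw f (M_cyc_s r d) (M_cyc_s (gcd r d) 0)))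
   \<and> (bij_betw cyc_twist (M_cyc_ss r d) (M_cyc_ss r (d + r))
      \<and> (0 < d \<and> d < r \<longrightarrow> bij_betw cyc_expand (M_cyc_ss d (d - r)) (M_cyc_ss r d))
      \<and> (\<exists>f. bij_betw f (M_cyc_ss r d) (M_cyc_ss (gcd r d) 0)))
   \<and> (finite (M_ch_ss r d) \<and> M_ch_ss r d \<noteq> {}
      \<and> (coprime r d \<longrightarrow> M_ch_s r d = M_ch_ss r d \<and> (\<exists>!a. a \<in> M_ch_ss r d))
      \<and> (\<not> coprime r d \<longrightarrow> M_ch_s r d = {}))
   \<and> (finite (M_cyc_ss r d) \<and> M_cyc_ss r d \<noteq> {}
      \<and> (coprime r d \<longrightarrow> M_cyc_s r d = M_cyc_ss r d \<and> (\<exists>!c. c \<in> M_cyc_ss r d))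
      \<and> (\<not> coprime r d \<longrightarrow> M_cyc_s r d = {}))"
proof -
  \<comment> \<open>Generalised over rank and degree, since the Euclidean recursion leaves the given
    pair.\<close>
  have ch_ss: "bij_betw chain_twist (M_ch_ss r d) (M_ch_ss r (d + r))"
    "0 < d \<and> d < r \<longrightarrow> bij_betw chain_expand (M_ch_ss d (d - r)) (M_ch_ss r d)" for r d
    using bij_betw_chain_twist[of 0] bij_betw_chain_expand[of d r 0] by (simp_all add: M_ch_ss_eq)
  have ch_s: "bij_betw chain_twist (M_ch_s r d) (M_ch_s r (d + r))"
    "0 < d \<and> d < r \<longrightarrow> bij_betw chain_expand (M_ch_s d (d - r)) (M_ch_s r d)" for r d
    using bij_betw_chain_twist[of 1] bij_betw_chain_expand[of d r 1] by (simp_all add: M_ch_s_eq)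
  have cyc_ss: "bij_betw cyc_twist (M_cyc_ss r d) (M_cyc_ss r (d + r))"
    "0 < d \<and> d < r \<longrightarrow> bij_betw cyc_expand (M_cyc_ss d (d - r)) (M_cyc_ss r d)" for r d
    using bij_betw_cyc_twist[of 0] bij_betw_cyc_expand[of d r 0] by (simp_all add: M_cyc_ss_eq)
  have cyc_s: "bij_betw cyc_twist (M_cyc_s r d) (M_cyc_s r (d + r))"
    "0 < d \<and> d < r \<longrightarrow> bij_betw cyc_expand (M_cyc_s d (d - r)) (M_cyc_s r d)" for r d
    using bij_betw_cyc_twist[of 1] bij_betw_cyc_expand[of d r 1] by (simp_all add: M_cyc_s_eq)
  have g1: "M_ch_ss r d \<approx> M_ch_ss (gcd r d) 0"
    by (rule eqpoll_gcd[OF _ _ r_pos]; unfold eqpoll_def; use ch_ss in blast)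
  have g2: "M_ch_s r d \<approx> M_ch_s (gcd r d) 0"
    by (rule eqpoll_gcd[OF _ _ r_pos]; unfold eqpoll_def; use ch_s in blast)
  have g3: "M_cyc_ss r d \<approx> M_cyc_ss (gcd r d) 0"
    by (rule eqpoll_gcd[OF _ _ r_pos]; unfold eqpoll_def; use cyc_ss in blast)
  have g4: "M_cyc_s r d \<approx> M_cyc_s (gcd r d) 0"
    by (rule eqpoll_gcd[OF _ _ r_pos]; unfold eqpoll_def; use cyc_s in blast)
  have ch2: "finite (M_ch_ss r d) \<and> M_ch_ss r d \<noteq> {}
      \<and> (coprime r d \<longrightarrow> M_ch_s r d = M_ch_ss r d \<and> (\<exists>!a. a \<in> M_ch_ss r d))
      \<and> (\<not> coprime r d \<longrightarrow> M_ch_s r d = {})"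
  proof (rule euclidean_families[OF g1 g2 _ _ _ _ _ r_pos])
    show "M_ch_s r d \<subseteq> M_ch_ss r d" by (auto simp: M_ch_s_def M_ch_ss_def chain_stable_def)
  qed (simp_all add: M_ch_ss_eq M_ch_s_eq ch_lists_rank_one finite_ch_lists
      ch_lists_degree_zero_nonempty ch_lists_stable_empty)
  have cyc2: "finite (M_cyc_ss r d) \<and> M_cyc_ss r d \<noteq> {}
      \<and> (coprime r d \<longrightarrow> M_cyc_s r d = M_cyc_ss r d \<and> (\<exists>!c. c \<in> M_cyc_ss r d))
      \<and> (\<not> coprime r d \<longrightarrow> M_cyc_s r d = {})"
  proof (rule euclidean_families[OF g3 g4 _ _ _ _ _ r_pos])
    show "M_cyc_s r d \<subseteq> M_cyc_ss r d" by (auto simp: M_cyc_s_def M_cyc_ss_def cyc_stable_def)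
  qed (simp_all add: M_cyc_ss_eq M_cyc_s_eq cyc_lists_rank_one finite_cyc_lists
      cyc_lists_degree_zero_nonempty cyc_lists_stable_empty)
  show ?thesis
    unfolding eqpoll_def[symmetric]
    by (rule ch2 cyc2 ch_ss ch_s cyc_ss cyc_s g1 g2 g3 g4 conjI)+
qed

end
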